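(* Let $\{c_n\}_{n\ge 1}$ be a sequence of positive numbers with $c_n\to\infty$ and let $f:\mathbb{R}\to\mathbb{R}$ be a Borel function. There exists a sequence of real numbers $\{b_n\}$ such that $$c_n^{-1}\Big(\sum_{k=1}^n f(a_k)-b_n\Big)\longrightarrow 0\quad\text{in } \mathrm{P}\text{-probability}$$ if and only if simultaneously $$n\,\mathrm{P}[|f(a_1)|>c_n]\to 0\qquad\text{and}\qquad \frac{n}{c_n^2}\,\mathrm{E}\big[f^2(a_1)I_{[|f(a_1)|\le c_n]}\big]\to 0 .$$ Moreover, if the latter two conditions are satisfied, then the convergence in probability holds with $b_n=n\,\mathrm{E}\big[f(a_1)I_{[|f(a_1)|\le c_n]}\big]$.
   Context: For irrational $x\in(0,1]$, $a_n(x)\in\mathbb{N}=\{1,2,\ldots\}$, $n\ge1$, denote the partial quotients (digits) of the simple non-terminating continued fraction expansion $x=\cfrac{1}{a_1(x)+\cfrac{1}{a_2(x)+\cdots}}$. The sequence $\{a_n\}$ is regarded as a random sequence on the probability space $((0,1],\mathcal{B},\mathrm{P})$, where $\mathcal{B}$ is the Borel $\sigma$-field of $(0,1]$ and $\mathrm{P}$ is the Gauss measure $\mathrm{P}(A)=\frac{1}{\ln 2}\int_A\frac{dx}{1+x}$. $\mathrm{E}$ denotes expectation with respect to $\mathrm{P}$ and $I_{[\cdot]}$ the indicator of an event.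
   Formalization: The equivalence is proved only when f is not a nonzero constant on {1,2,...}: for f=1, c_n=√n, b_n=n the convergence holds but (n/c_n²)E[f²(a_1)I]=1. The "if" half and the "moreover" part are proved for every Borel f. *)

theory Defs
  imports "HOL-Probability.Probability"
begin

definition gauss_map :: "real \<Rightarrow> real" where
  "gauss_map x = frac (1 / x)"

(* The n-th partial quotient a_n(x), for n >= 1.  On rational x, where the expansion terminates,
   the value is the junk value 0 from some n on; the rationals are a null set of the Gauss measure. *)
definition cf_digit :: "nat \<Rightarrow> real \<Rightarrow> nat" where
  "cf_digit n x = nat \<lfloor>1 / (gauss_map ^^ (n - 1)) x\<rfloor>"

(* cf_value a n t = 1/(a 1 + 1/(a 2 + ... + 1/(a n + t))) *)
fun cf_value :: "(nat \<Rightarrow> nat) \<Rightarrow> nat \<Rightarrow> real \<Rightarrow> real" where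
  "cf_value a 0 t = t"
| "cf_value a (Suc n) t = cf_value a n (1 / (real (a (Suc n)) + t))"

lemma cf_value_shift:
  "cf_value a (Suc n) t = 1 / (real (a 1) + cf_value (\<lambda>k. a (Suc k)) n t)"
  by (induction n arbitrary: t) auto

lemma gauss_map_irrational:
  assumes "x \<in> {0<..1}" "x \<notin> \<rat>"
  shows "gauss_map x \<in> {0<..1}" "gauss_map x \<notin> \<rat>"
proof -
  have "1 / x \<notin> \<rat>"
  proof
    assume "1 / x \<in> \<rat>"
    from Rats_divide[OF Rats_1 this] have "1 / (1 / x) \<in> \<rat>" .
    also have "1 / (1 / x) = x" using assms by auto
    finally show False using assms by simp
  qed
  show irr: "gauss_map x \<notin> \<rat>"
  proof
    assume "gauss_map x \<in> \<rat>"
    then have "gauss_map x + of_int \<lfloor>1 / x\<rfloor> \<in> \<rat>" by (intro Rats_add) auto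
    with \<open>1 / x \<notin> \<rat>\<close> show False by (simp add: gauss_map_def frac_def)
  qed
  have "0 \<le> gauss_map x" "gauss_map x < 1"
    by (auto simp: gauss_map_def frac_ge_0 frac_lt_1)
  moreover have "gauss_map x \<noteq> 0" using irr by (metis Rats_0)
  ultimately show "gauss_map x \<in> {0<..1}" by auto
qed

lemma gauss_map_iter_irrational:
  assumes "x \<in> {0<..1}" "x \<notin> \<rat>"
  shows "(gauss_map ^^ n) x \<in> {0<..1} \<and> (gauss_map ^^ n) x \<notin> \<rat>"
  using assms gauss_map_irrational by (induction n) auto

lemma cf_digit_Suc:
  assumes "n \<ge> 1"
  shows "cf_digit (Suc n) x = cf_digit n (gauss_map x)"
  using assms by (cases n) (auto simp: cf_digit_def funpow_swap1)

lemma cf_digit_ge_1: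
  assumes "x \<in> {0<..1}" "x \<notin> \<rat>"
  shows "cf_digit n x \<ge> 1"
proof -
  have "(gauss_map ^^ (n - 1)) x \<in> {0<..1}" using gauss_map_iter_irrational[OF assms] by blast
  then have "1 \<le> 1 / (gauss_map ^^ (n - 1)) x" by simp
  then have "1 \<le> \<lfloor>1 / (gauss_map ^^ (n - 1)) x\<rfloor>" by linarith
  then show ?thesis unfolding cf_digit_def by linarith
qed

lemma cf_value_digits:
  assumes "x \<in> {0<..1}" "x \<notin> \<rat>"
  shows "cf_value (\<lambda>k. cf_digit k x) n ((gauss_map ^^ n) x) = x"
proof (induction n)
  case (Suc n)
  define y where "y = (gauss_map ^^ n) x"
  have y: "y \<in> {0<..1}" using gauss_map_iter_irrational[OF assms] y_def by blast
  have "real (cf_digit (Suc n) x) + gauss_map y = 1 / y"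
    using y by (simp add: cf_digit_def gauss_map_def frac_def y_def[symmetric])
  then show ?case using Suc y by (simp add: y_def[symmetric])
qed simp

lemma cf_value_nonneg: "t \<ge> 0 \<Longrightarrow> cf_value a n t \<ge> 0"
  by (induction n arbitrary: t) auto

lemma cf_value_contract:
  assumes "\<forall>k\<ge>1. a k \<ge> 1" "s \<in> {0..1}" "t \<in> {0..1}"
  shows "\<bar>cf_value a n s - cf_value a n t\<bar> \<le> 2 * (1 / 2) ^ (n div 2)"
  using assms
proof (induction n arbitrary: a rule: less_induct)
  case (less n)
  consider "n = 0" | "n = 1" | m where "n = Suc (Suc m)" by (metis One_nat_def not0_implies_Suc)
  then show ?case
  proof cases
    case 1
    then show ?thesis using less.prems by auto
  next
    case 2
    have bd: "0 \<le> 1 / (real (a 1) + u) \<and> 1 / (real (a 1) + u) \<le> 1" if "u \<in> {0..1}" for u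
    proof -
      have "real (a 1) \<ge> 1" using less.prems(1) by (metis le_refl of_nat_1 of_nat_le_iff)
      then show ?thesis using that by (auto simp: divide_simps)
    qed
    have e: "cf_value a n u = 1 / (real (a 1) + u)" for u by (simp add: 2)
    have "\<bar>u - v\<bar> \<le> 2" if "0 \<le> u \<and> u \<le> 1" "0 \<le> v \<and> v \<le> 1" for u v :: real
      using that by linarith
    from this[OF bd[OF less.prems(2)] bd[OF less.prems(3)]]
    have "\<bar>cf_value a n s - cf_value a n t\<bar> \<le> 2" by (simp only: e)
    also have "2 = 2 * (1 / 2 :: real) ^ (n div 2)" by (simp add: 2)
    finally show ?thesis .
  next
    case 3
    define b where "b = (\<lambda>k. a (Suc (Suc k)))"
    define p where "p = cf_value b m s"
    define q where "q = cf_value b m t"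
    have pq: "p \<ge> 0" "q \<ge> 0" using less.prems by (auto simp: p_def q_def intro!: cf_value_nonneg)
    have a: "real (a 1) \<ge> 1" "real (a 2) \<ge> 1"
      using less.prems(1)[rule_format, of 1] less.prems(1)[rule_format, of 2] by linarith+
    have IH: "\<bar>p - q\<bar> \<le> 2 * (1 / 2) ^ (m div 2)"
      unfolding p_def q_def using less.IH[of m b] less.prems 3 by (auto simp: b_def)
    have ex: "cf_value a n u = (real (a 2) + cf_value b m u) / (real (a 1) * (real (a 2) + cf_value b m u) + 1)"
      if "cf_value b m u \<ge> 0" for u
    proof -
      have pos: "real (a 2) + cf_value b m u > 0" using a that by linarith
      have "cf_value a n u = 1 / (real (a 1) + 1 / (real (a 2) + cf_value b m u))"
        unfolding 3 cf_value_shift b_def by (simp add: numeral_2_eq_2)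
      also have "\<dots> = (real (a 2) + cf_value b m u) / (real (a 1) * (real (a 2) + cf_value b m u) + 1)"
        using pos by (auto simp: divide_simps)
      finally show ?thesis .
    qed
    define P where "P = real (a 1) * (real (a 2) + p) + 1"
    define Q where "Q = real (a 1) * (real (a 2) + q) + 1"
    have "1 * 1 \<le> real (a 1) * (real (a 2) + p)" using a pq by (intro mult_mono) auto
    then have P: "P \<ge> 2" by (simp add: P_def)
    have "1 * 1 \<le> real (a 1) * (real (a 2) + q)" using a pq by (intro mult_mono) auto
    then have Q: "Q \<ge> 2" by (simp add: Q_def)
    have "cf_value a n s - cf_value a n t = (real (a 2) + p) / P - (real (a 2) + q) / Q"
      using ex[of s] ex[of t] pq by (simp add: p_def q_def P_def Q_def)
    also have "\<dots> = ((real (a 2) + p) * Q - (real (a 2) + q) * P) / (P * Q)"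
      using P Q by (simp add: diff_frac_eq)
    also have "(real (a 2) + p) * Q - (real (a 2) + q) * P = p - q"
      by (simp add: P_def Q_def algebra_simps)
    finally have "\<bar>cf_value a n s - cf_value a n t\<bar> = \<bar>p - q\<bar> / (P * Q)"
      using P Q by (simp add: abs_mult)
    also have "\<dots> \<le> \<bar>p - q\<bar> / 2"
    proof -
      have "2 * 1 \<le> P * Q" using P Q by (intro mult_mono) auto
      then show ?thesis by (intro divide_left_mono) auto
    qed
    also have "\<dots> \<le> 2 * (1 / 2) ^ (n div 2)" using IH 3 by simp
    finally show ?thesis .
  qed
qed

lemma half_power_tendsto_0: "(\<lambda>n. 2 * (1 / 2 :: real) ^ (n div 2)) \<longlonglongrightarrow> 0"
proof -
  have "filterlim (\<lambda>n::nat. n div 2) sequentially sequentially"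
    by (auto simp: filterlim_at_top eventually_sequentially) (metis div_le_mono nonzero_mult_div_cancel_left zero_neq_numeral)
  then have "(\<lambda>n. (1 / 2 :: real) ^ (n div 2)) \<longlonglongrightarrow> 0"
    using filterlim_compose[OF LIMSEQ_power_zero[of "1 / 2 :: real"]] by simp
  then show ?thesis using tendsto_mult_right_zero by blast
qed

theorem cf_digits_expansion:
  assumes "x \<in> {0<..1}" "x \<notin> \<rat>"
  shows "(\<lambda>n. cf_value (\<lambda>k. cf_digit k x) n 0) \<longlonglongrightarrow> x"
proof (rule Lim_transform)
  show "(\<lambda>n. x) \<longlonglongrightarrow> x" by simp
  show "(\<lambda>n. cf_value (\<lambda>k. cf_digit k x) n 0 - x) \<longlonglongrightarrow> 0"
  proof (rule tendsto_0_le[where K = 1, OF half_power_tendsto_0], intro always_eventually allI)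
    fix n
    have "\<bar>cf_value (\<lambda>k. cf_digit k x) n 0 - cf_value (\<lambda>k. cf_digit k x) n ((gauss_map ^^ n) x)\<bar>
        \<le> 2 * (1 / 2) ^ (n div 2)"
      using gauss_map_iter_irrational[OF assms, of n] cf_digit_ge_1[OF assms]
      by (intro cf_value_contract) auto
    then show "norm (cf_value (\<lambda>k. cf_digit k x) n 0 - x) \<le> norm (2 * (1 / 2 :: real) ^ (n div 2)) * 1"
      unfolding cf_value_digits[OF assms] by simp
  qed
qed

theorem cf_digits_unique:
  assumes "x \<in> {0<..1}" "x \<notin> \<rat>" and "\<forall>k\<ge>1. a k \<ge> 1"
    and "(\<lambda>n. cf_value a n 0) \<longlonglongrightarrow> x" and "k \<ge> 1"
  shows "a k = cf_digit k x"
proof -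
  have *: "cf_digit 1 x = a 1 \<and> (\<lambda>n. cf_value (\<lambda>k. a (Suc k)) n 0) \<longlonglongrightarrow> gauss_map x"
    if x: "x \<in> {0<..1}" "x \<notin> \<rat>" and a: "\<forall>k\<ge>1. a k \<ge> 1"
      and lim: "(\<lambda>n. cf_value a n 0) \<longlonglongrightarrow> x" for a x
  proof -
    let ?v = "\<lambda>n. cf_value (\<lambda>k. a (Suc k)) n 0"
    have a1: "real (a 1) \<ge> 1" using a by (metis le_refl of_nat_1 of_nat_le_iff)
    have v0: "?v n \<ge> 0" for n by (simp add: cf_value_nonneg)
    have v1: "?v n \<le> 1" for n
    proof (cases n)
      case (Suc m)
      have "real (a (Suc 1)) \<ge> 1" using a by (metis One_nat_def le_SucI le_refl of_nat_1 of_nat_le_iff)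
      moreover have "cf_value (\<lambda>k. a (Suc (Suc k))) m 0 \<ge> 0" by (simp add: cf_value_nonneg)
      ultimately have "1 / (real (a (Suc 1)) + cf_value (\<lambda>k. a (Suc (Suc k))) m 0) \<le> 1"
        by (simp add: divide_simps)
      then show ?thesis unfolding Suc cf_value_shift by simp
    qed simp
    have "(\<lambda>n. cf_value a (Suc n) 0) \<longlonglongrightarrow> x" using lim by (rule LIMSEQ_Suc)
    then have "(\<lambda>n. 1 / (real (a 1) + ?v n)) \<longlonglongrightarrow> x" unfolding cf_value_shift .
    then have "(\<lambda>n. 1 / (1 / (real (a 1) + ?v n)) - real (a 1)) \<longlonglongrightarrow> 1 / x - real (a 1)"
      using x by (intro tendsto_intros) auto
    then have v: "?v \<longlonglongrightarrow> 1 / x - real (a 1)" by simp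
    have y: "0 \<le> 1 / x - real (a 1)" "1 / x - real (a 1) \<le> 1"
      using LIMSEQ_le_const[OF v, of 0] LIMSEQ_le_const2[OF v, of 1] v0 v1 by blast+
    have "1 / x - real (a 1) \<noteq> 1"
    proof
      assume "1 / x - real (a 1) = 1"
      then have "x = 1 / (1 + real (a 1))" using x(1) by (auto simp: field_simps)
      also have "\<dots> \<in> \<rat>" by (intro Rats_divide Rats_add) auto
      finally show False using x by simp
    qed
    then have fl: "\<lfloor>1 / x\<rfloor> = int (a 1)" using y by (simp add: floor_eq_iff)
    then show ?thesis using v by (simp add: cf_digit_def gauss_map_def frac_def)
  qed
  show ?thesis
    using \<open>k \<ge> 1\<close> assms(1-4)
  proof (induction k arbitrary: a x rule: dec_induct)
    case base
    then show ?case using * by metis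
  next
    case (step k)
    have "a (Suc k) = cf_digit k (gauss_map x)"
      using step.IH[of "gauss_map x" "\<lambda>k. a (Suc k)"] gauss_map_irrational[OF step.prems(1,2)]
        *[OF step.prems] step.prems(3) by auto
    then show ?case using cf_digit_Suc step.hyps by simp
  qed
qed

definition gauss_measure :: "real measure" where
  "gauss_measure = density (restrict_space lborel {0<..1}) (\<lambda>x. ennreal (1 / (ln 2 * (1 + x))))"

lemma prob_space_gauss_measure: "prob_space gauss_measure"
proof
  have "{0<..1} \<in> sets (restrict_space lborel {0<..1::real})"
    using sets.top[of "restrict_space lborel {0<..1::real}"] by (simp add: space_restrict_space)
  then have "emeasure gauss_measure (space gauss_measure)
      = (\<integral>\<^sup>+x. ennreal (1 / (ln 2 * (1 + x))) \<partial>restrict_space lborel {0<..1})"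
    unfolding gauss_measure_def space_density
    by (subst emeasure_density) (auto simp: space_restrict_space intro!: measurable_restrict_space1 nn_integral_cong)
  also have "\<dots> = (\<integral>\<^sup>+x. ennreal (1 / (ln 2 * (1 + x))) * indicator {0<..1} x \<partial>lborel)"
    by (subst nn_integral_restrict_space) auto
  also have "\<dots> = (\<integral>\<^sup>+x. ennreal (1 / (ln 2 * (1 + x))) * indicator {0..1} x \<partial>lborel)"
    by (intro nn_integral_cong_AE) (use AE_lborel_singleton[of "0::real"] in \<open>auto simp: indicator_def elim!: eventually_mono\<close>)
  also have "\<dots> = ennreal (ln (1 + 1) / ln 2 - ln (1 + 0) / ln 2)"
  proof (rule nn_integral_FTC_Icc[where F = "\<lambda>x. ln (1 + x) / ln 2"])
    fix x :: real
    assume x: "x \<in> {0..1}"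
    have "((\<lambda>x. ln (1 + x) / ln 2) has_real_derivative (1 / (1 + x)) / ln 2) (at x)"
      by (rule DERIV_cdivide) (use x in \<open>auto intro!: derivative_eq_intros\<close>)
    then show "((\<lambda>x. ln (1 + x) / ln 2) has_real_derivative 1 / (ln 2 * (1 + x))) (at x)"
      by (simp only: divide_divide_eq_left mult.commute)
    show "0 \<le> 1 / (ln 2 * (1 + x))" using x by simp
  next
    show "(\<lambda>x. 1 / (ln 2 * (1 + x)) :: real) \<in> borel_measurable borel" by measurable
  qed simp
  finally show "emeasure gauss_measure (space gauss_measure) = 1" by simp
qed

definition conv_in_prob :: "'a measure \<Rightarrow> (nat \<Rightarrow> 'a \<Rightarrow> real) \<Rightarrow> ('a \<Rightarrow> real) \<Rightarrow> bool" where
  "conv_in_prob M X Y \<longleftrightarrow>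
    (\<forall>\<epsilon>>0. (\<lambda>n. \<P>(\<omega> in M. \<bar>X n \<omega> - Y \<omega>\<bar> > \<epsilon>)) \<longlonglongrightarrow> 0)"

end

theory Submission
  imports Defs
begin

text \<open>
  The Gauss-Kuzmin-Wirsing operator $L w(x) = \sum_k p_k(x)\, w(1/(k+x))$ with
  $p_k(x) = (1+x)/((k+x)(k+x+1))$ is the transfer operator of the Gauss map with respect to the
  Gauss measure, and it contracts Lipschitz seminorms by the factor 7/8.  Applied to covariances,
  this gives a variance bound $C n E g^2$ for sums of a bounded function $g$ of the digits, and
  sufficiency follows by truncation and Chebyshev's inequality.

  For necessity, the expectation of $\prod_{k \le n} h(a_k)$, $|h| \le 1$, equals that of
  $L_h^n 1$, where $L_h$ carries the additional factor $h(k)$.  Let $D = 1 - |\sum_k \mu_k h(k)|^2$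
  with $\mu_k = p_k(0)$.  The Lipschitz seminorm of $L_h^n 1$ stays below a multiple of
  $\sqrt D$ times its sup norm, and since $p_k \ge \mu_k/2$ a fixed power of $L_h$ dominates
  a multiple of the operator with independent digits of law $\mu$, whence the sup norm of
  $L_h^n 1$ is at most $(1 - \kappa D)^{\lfloor n/13 \rfloor}$.  For $h = e^{itf/c_n}$,
  convergence in probability forces $n D \to 0$ uniformly in $t \in [0,2]$, and integrating over $t$
  gives $n \sum_k \mu_k \min(1, (f(k)-f(1))^2/c_n^2) \to 0$.
\<close>

subsection \<open>Digit weights and weighted transfer operators\<close>

text \<open>A spectral gap for one fixed h would not be enough: e^{itf/c_n} tends to 1 pointwise, so
  D tends to 0 as n grows, and the decay rate has to be linear in D with constants that depend on
  nothing else. The model is that of independent digits, where the expectation of the product has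
  modulus |sum mu_k h(k)|^n = (1-D)^{n/2}. The obstacle is that L_h^n 1 is not constant: its
  oscillation has to be small against D and not merely small, which is why sup norm and Lipschitz
  seminorm are tracked together. Only the modulus of the characteristic function is available,
  because b_n is arbitrary, and D does not change when h is multiplied by a number of modulus one.
  Hence only differences of values of f can be recovered. The reference value is f(1), since the
  digit 1 has weight 1/2 under mu. The average over t is needed because for a single t a large
  difference y may still satisfy e^{ity} = 1.\<close>

text \<open>Index shift: weight $k$ belongs to the digit $k + 1$.\<close>
definition cf_weight :: "nat \<Rightarrow> real \<Rightarrow> real" where
  "cf_weight k x = (1 + x) / ((real k + 1 + x) * (real k + 2 + x))"

text \<open>The sum of \<open>cf_weight j x\<close> over all \<open>j >= k\<close> in closed form;
  the weights telescope through it.\<close>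

definition cf_tail :: "nat \<Rightarrow> real \<Rightarrow> real" where
  "cf_tail k x = (1 + x) / (real k + 1 + x)"

lemma cf_weight_eq_tail_diff: "x \<ge> 0 \<Longrightarrow> cf_weight k x = cf_tail k x - cf_tail (Suc k) x"
  unfolding cf_weight_def cf_tail_def by (simp add: divide_simps) (simp add: algebra_simps)

lemma cf_tail_tendsto_0: "(\<lambda>k. cf_tail k x) \<longlonglongrightarrow> 0"
  unfolding cf_tail_def by real_asymp

lemma cf_weight_sums_1:
  assumes "x \<ge> 0"
  shows "(\<lambda>k. cf_weight k x) sums 1"
proof -
  have "(\<Sum>k<n. cf_weight k x) = 1 - cf_tail n x" for n
    by (induction n) (use assms in \<open>auto simp: cf_weight_eq_tail_diff\<close>, simp add: cf_tail_def)
  moreover have "(\<lambda>n. 1 - cf_tail n x) \<longlonglongrightarrow> 1 - 0"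
    by (intro tendsto_intros cf_tail_tendsto_0)
  ultimately show ?thesis by (simp add: sums_def)
qed

lemma cf_weight_nonneg: "x \<ge> 0 \<Longrightarrow> cf_weight k x \<ge> 0"
  by (simp add: cf_weight_def)

text \<open>The inverse branch of the digit 1 has slope of modulus 1 at 0, while all the others
  contract by 1/4. A bound on its weight is therefore what makes the branches contract on
  average.\<close>

lemma cf_weight_0_le: "x \<ge> 0 \<Longrightarrow> cf_weight 0 x \<le> 1 / 2"
  by (simp add: cf_weight_def divide_simps)

lemma cf_weight_le:
  assumes "x \<in> {0..1}"
  shows "cf_weight k x \<le> 2 * cf_weight k 0"
proof -
  have "cf_weight k x \<le> 2 / ((real k + 1) * (real k + 2))"
    unfolding cf_weight_def using assms by (intro frac_le mult_mono) auto
  then show ?thesis by (simp add: cf_weight_def)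
qed

text \<open>The numerator \<open>1 + x\<close> pays for the growth of the first factor, as
  \<open>k + 1 + x <= (k + 1) * (1 + x)\<close>; the second factor at most doubles.\<close>

lemma cf_weight_ge:
  assumes "x \<in> {0..1}"
  shows "cf_weight k 0 / 2 \<le> cf_weight k x"
proof -
  have "(real k + 1 + x) * (real k + 2 + x) \<le> ((real k + 1) * (1 + x)) * (2 * (real k + 2))"
    using assms by (intro mult_mono) (auto simp: algebra_simps)
  then show ?thesis using assms
    unfolding cf_weight_def by (simp add: divide_simps) (simp add: algebra_simps)
qed

text \<open>The bound is relative to \<open>cf_weight k 0\<close>, so it can be summed against any
  bounded function of the digit and yields an expectation under mu.\<close>

lemma cf_weight_diff_le:
  assumes "x \<ge> 0" "y \<ge> 0"
  shows "\<bar>cf_weight k x - cf_weight k y\<bar> \<le> 4 * \<bar>x - y\<bar> * cf_weight k 0"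
proof -
  define a b where "a = real k + 1 + x" and "b = real k + 1 + y"
  have ab: "a \<ge> real k + 1" "b \<ge> real k + 1" using assms by (auto simp: a_def b_def)
  have e: "cf_weight k x - cf_weight k y = (y - x) * (a * b - real k * (a + b + 1)) / ((a * b) * ((a + 1) * (b + 1)))"
  proof -
    have wx: "cf_weight k x = (a - real k) / (a * (a + 1))" by (simp add: cf_weight_def a_def add_ac)
    have wy: "cf_weight k y = (b - real k) / (b * (b + 1))" by (simp add: cf_weight_def b_def add_ac)
    have yx: "y - x = b - a" by (simp add: a_def b_def)
    show ?thesis unfolding wx wy yx
    proof (subst diff_frac_eq)
      have "a * (a + 1) > 0" "b * (b + 1) > 0" using ab by auto
      then show "a * (a + 1) \<noteq> 0" "b * (b + 1) \<noteq> 0" by linarith+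
    qed (simp add: algebra_simps)
  qed
  \<comment> \<open>As \<open>a\<close> and \<open>b\<close> are at least \<open>k + 1\<close>, each
    of the three products subtracted from \<open>a * b\<close> lies between 0 and
    \<open>a * b\<close>.\<close>
  have "real k * a \<le> a * b" "real k * b \<le> a * b" using ab by (auto intro: mult_mono)
  moreover have "real k * 1 \<le> a * b" using ab by (intro mult_mono) auto
  moreover have "0 \<le> real k * (a + b + 1)" "0 \<le> a * b" using ab by auto
  ultimately have n: "\<bar>a * b - real k * (a + b + 1)\<bar> \<le> 4 * (a * b)"
    by (simp add: algebra_simps abs_le_iff)
  have "\<bar>cf_weight k x - cf_weight k y\<bar> = \<bar>x - y\<bar> * (\<bar>a * b - real k * (a + b + 1)\<bar> / ((a * b) * ((a + 1) * (b + 1))))"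
    unfolding e using ab by (simp add: abs_mult abs_minus_commute)
  also have "\<dots> \<le> \<bar>x - y\<bar> * (4 * (a * b) / ((a * b) * ((a + 1) * (b + 1))))"
    using n ab by (intro mult_left_mono divide_right_mono) auto
  also have "\<dots> = \<bar>x - y\<bar> * (4 / ((a + 1) * (b + 1)))" using ab by simp
  also have "\<dots> \<le> \<bar>x - y\<bar> * (4 / ((real k + 1) * (real k + 2)))"
    using ab by (intro mult_left_mono divide_left_mono mult_mono) auto
  also have "\<dots> = 4 * \<bar>x - y\<bar> * cf_weight k 0" by (simp add: cf_weight_def)
  finally show ?thesis .
qed

section \<open>Inverse branches and the operators built from them\<close>

lemma inverse_shift_in_unit: "x \<ge> 0 \<Longrightarrow> 1 / (real k + 1 + x) \<in> {0..1}"
  by simp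

lemma inverse_shift_diff_le:
  assumes "x \<ge> 0" "y \<ge> 0"
  shows "\<bar>1 / (real k + 1 + x) - 1 / (real k + 1 + y)\<bar> \<le> (if k = 0 then 1 else 1 / 4) * \<bar>x - y\<bar>"
proof -
  have "\<bar>1 / (real k + 1 + x) - 1 / (real k + 1 + y)\<bar> = \<bar>x - y\<bar> / ((real k + 1 + x) * (real k + 1 + y))"
    using assms by (simp add: diff_frac_eq abs_mult abs_minus_commute)
  also have "\<dots> \<le> \<bar>x - y\<bar> / (if k = 0 then 1 else 4)"
  proof (cases "k = 0")
    case False
    then have "2 * 2 \<le> (real k + 1 + x) * (real k + 1 + y)" using assms by (intro mult_mono) auto
    then show ?thesis using False by (intro divide_left_mono) auto
  next
    case True
    have "1 * 1 \<le> (1 + x) * (1 + y)" using assms by (intro mult_mono) auto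
    then show ?thesis using True by (intro divide_left_mono) auto
  qed
  finally show ?thesis by (simp add: mult.commute split: if_splits)
qed

text \<open>With \<open>cf_weight\<close> this is the Gauss-Kuzmin-Wirsing operator twisted by
  \<open>h\<close>. \<open>iid_op\<close> freezes the weights at 0 but keeps the inverse branches:
  its iterates average over independent digits of law mu, with \<open>w\<close> still evaluated at
  the continued fraction formed from them. The value type is real for variances and complex for
  characteristic functions.\<close>

definition digit_op :: "(nat \<Rightarrow> real \<Rightarrow> real) \<Rightarrow> (nat \<Rightarrow> 'a) \<Rightarrow> (real \<Rightarrow> 'a) \<Rightarrow> real \<Rightarrow> 'a::{real_normed_field,banach}" where
  "digit_op q h w x = (\<Sum>k. q k x *\<^sub>R (h (Suc k) * w (1 / (real k + 1 + x))))"

abbreviation "gauss_op \<equiv> digit_op cf_weight"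
abbreviation "iid_op \<equiv> digit_op (\<lambda>k _. cf_weight k 0)"

lemma norm_weighted_suminf_le:
  fixes v :: "nat \<Rightarrow> 'a::banach"
  assumes "summable q" "\<And>k. q k \<ge> 0" "\<And>k. norm (v k) \<le> M"
  shows "summable (\<lambda>k. q k *\<^sub>R v k)" "norm (\<Sum>k. q k *\<^sub>R v k) \<le> M * suminf q"
proof -
  have M: "summable (\<lambda>k. M * q k)" using assms(1) by (rule summable_mult)
  have le: "norm (q k *\<^sub>R v k) \<le> M * q k" for k
    using mult_left_mono[OF assms(3)[of k] assms(2)[of k]] assms(2)[of k] by (simp add: mult.commute)
  have s: "summable (\<lambda>k. norm (q k *\<^sub>R v k))"
    by (rule summable_comparison_test'[OF M, of 0]) (use le in auto)
  show "summable (\<lambda>k. q k *\<^sub>R v k)" using s by (rule summable_norm_cancel)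
  have "norm (\<Sum>k. q k *\<^sub>R v k) \<le> (\<Sum>k. norm (q k *\<^sub>R v k))" by (rule summable_norm[OF s])
  also have "\<dots> \<le> (\<Sum>k. M * q k)" by (rule suminf_le[OF le s M])
  also have "\<dots> = M * suminf q" using assms(1) by (rule suminf_mult)
  finally show "norm (\<Sum>k. q k *\<^sub>R v k) \<le> M * suminf q" .
qed

lemma abel_sum_diff:
  fixes v :: "nat \<Rightarrow> 'a::real_vector"
  assumes "d 0 = 0"
  shows "(\<Sum>k<Suc n. (d k - d (Suc k)) *\<^sub>R v k) = (\<Sum>k<n. d (Suc k) *\<^sub>R (v (Suc k) - v k)) - d (Suc n) *\<^sub>R v n"
  using assms by (induction n) (auto simp: algebra_simps)

text \<open>Abel summation against the tails $(1+x)/(k+1+x)$ avoids the non-monotone weights.\<close>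
lemma cf_weight_diff_suminf_le:
  fixes w :: "real \<Rightarrow> 'a::banach"
  assumes lip: "l-lipschitz_on {0..1} w" and x: "x \<in> {0..1}" "y \<in> {0..1}"
    and M: "\<And>t. t \<in> {0..1} \<Longrightarrow> norm (w t) \<le> M"
  shows "norm (\<Sum>k. (cf_weight k x - cf_weight k y) *\<^sub>R w (1 / (real k + 1 + y))) \<le> l / 4 * \<bar>x - y\<bar>"
proof -
  define v where "v k = w (1 / (real k + 1 + y))" for k
  define d where "d k = cf_tail k x - cf_tail k y" for k
  have l: "l \<ge> 0" using lip by (rule lipschitz_on_nonneg)
  have vM: "norm (v k) \<le> M" for k unfolding v_def by (rule M) (use x in auto)
  have d0: "d 0 = 0" using x by (simp add: d_def cf_tail_def)
  have dle: "\<bar>d (Suc k)\<bar> \<le> \<bar>x - y\<bar> * ((real k + 1) / (real k + 2)\<^sup>2)" for k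
  proof -
    have "d (Suc k) = (x - y) * ((real k + 1) / ((real k + 2 + x) * (real k + 2 + y)))"
      unfolding d_def cf_tail_def using x by (simp add: divide_simps) (simp add: algebra_simps)
    then have "\<bar>d (Suc k)\<bar> = \<bar>x - y\<bar> * ((real k + 1) / ((real k + 2 + x) * (real k + 2 + y)))"
      using x by (simp add: abs_mult)
    also have "\<dots> \<le> \<bar>x - y\<bar> * ((real k + 1) / (real k + 2)\<^sup>2)"
      unfolding power2_eq_square using x by (intro mult_left_mono divide_left_mono mult_mono) auto
    finally show ?thesis .
  qed
  have vle: "norm (v (Suc k) - v k) \<le> l / ((real k + 1) * (real k + 2))" for k
  proof -
    have "norm (v (Suc k) - v k) \<le> l * dist (1 / (real (Suc k) + 1 + y)) (1 / (real k + 1 + y))"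
      unfolding v_def dist_norm[symmetric] by (rule lipschitz_onD[OF lip]) (use x in auto)
    also have "dist (1 / (real (Suc k) + 1 + y)) (1 / (real k + 1 + y)) = 1 / ((real k + 1 + y) * (real k + 2 + y))"
    proof -
      have "1 / (real k + 1 + y) - 1 / (real (Suc k) + 1 + y) = 1 / ((real k + 1 + y) * (real k + 2 + y))"
        using x by (simp add: divide_simps)
      moreover have "1 / ((real k + 1 + y) * (real k + 2 + y)) \<ge> 0" using x by simp
      ultimately show ?thesis unfolding dist_real_def by linarith
    qed
    also have "l * \<dots> \<le> l * (1 / ((real k + 1) * (real k + 2)))"
      using x l by (intro mult_left_mono divide_left_mono mult_mono) auto
    finally show ?thesis by simp
  qed
  have tb: "norm (d (Suc k) *\<^sub>R (v (Suc k) - v k)) \<le> l * \<bar>x - y\<bar> * (1 / ((real k + 1) * (real k + 2) * (real k + 3)))" for k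
  proof -
    have "norm (d (Suc k) *\<^sub>R (v (Suc k) - v k)) \<le>
      (\<bar>x - y\<bar> * ((real k + 1) / (real k + 2)\<^sup>2)) * (l / ((real k + 1) * (real k + 2)))"
      unfolding norm_scaleR using dle vle by (intro mult_mono) auto
    also have "\<dots> = l * \<bar>x - y\<bar> * (1 / (real k + 2) ^ 3)"
      by (simp add: power2_eq_square power3_eq_cube mult_ac)
    also have "\<dots> \<le> l * \<bar>x - y\<bar> * (1 / ((real k + 1) * (real k + 2) * (real k + 3)))"
    proof (intro mult_left_mono divide_left_mono)
      show "(real k + 1) * (real k + 2) * (real k + 3) \<le> (real k + 2) ^ 3"
        by (simp add: power3_eq_cube algebra_simps)
    qed (use l in auto)
    finally show ?thesis .
  qed
  \<comment> \<open>This is why the cube was replaced by a product of consecutive factors: the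
    product telescopes, and its sum 1/4 is the constant of the claim.\<close>
  have pf: "1 / ((real k + 1) * (real k + 2) * (real k + 3)) = 1 / (2 * (real k + 1) * (real k + 2)) - 1 / (2 * (real (Suc k) + 1) * (real (Suc k) + 2))" for k
    by (simp add: divide_simps) (simp add: algebra_simps)
  have tele: "(\<Sum>k<n. 1 / ((real k + 1) * (real k + 2) * (real k + 3))) = 1 / 4 - 1 / (2 * (real n + 1) * (real n + 2))" for n
    unfolding pf by (induction n) auto
  have tele_le: "(\<Sum>k<n. 1 / ((real k + 1) * (real k + 2) * (real k + 3))) \<le> 1 / 4" for n
    unfolding tele by simp
  have dw: "cf_weight k x - cf_weight k y = d k - d (Suc k)" for k
    using x by (simp add: d_def cf_weight_eq_tail_diff)
  \<comment> \<open>The bound \<open>M\<close> enters only through the boundary term of the Abel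
    summation, which vanishes in the limit; the result depends on the Lipschitz constant
    alone.\<close>
  have part: "norm (\<Sum>k<Suc n. (cf_weight k x - cf_weight k y) *\<^sub>R v k) \<le> l / 4 * \<bar>x - y\<bar> + \<bar>d (Suc n)\<bar> * M" for n
  proof -
    have "norm (\<Sum>k<Suc n. (cf_weight k x - cf_weight k y) *\<^sub>R v k)
        = norm ((\<Sum>k<n. d (Suc k) *\<^sub>R (v (Suc k) - v k)) - d (Suc n) *\<^sub>R v n)"
      unfolding dw by (subst abel_sum_diff[of d, OF d0]) simp
    also have "\<dots> \<le> norm (\<Sum>k<n. d (Suc k) *\<^sub>R (v (Suc k) - v k)) + norm (d (Suc n) *\<^sub>R v n)"
      by (rule norm_triangle_ineq4)
    also have "norm (\<Sum>k<n. d (Suc k) *\<^sub>R (v (Suc k) - v k)) \<le> 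
      (\<Sum>k<n. l * \<bar>x - y\<bar> * (1 / ((real k + 1) * (real k + 2) * (real k + 3))))"
      by (rule order_trans[OF norm_sum sum_mono[OF tb]])
    also have "\<dots> = l * \<bar>x - y\<bar> * (\<Sum>k<n. 1 / ((real k + 1) * (real k + 2) * (real k + 3)))"
      by (simp add: sum_distrib_left)
    also have "\<dots> \<le> l * \<bar>x - y\<bar> * (1 / 4)"
      using l by (intro mult_left_mono tele_le) auto
    also have "norm (d (Suc n) *\<^sub>R v n) \<le> \<bar>d (Suc n)\<bar> * M"
      using vM by (simp add: mult_left_mono)
    finally show ?thesis by (simp add: mult_ac)
  qed
  have sm: "summable (\<lambda>k. (cf_weight k x - cf_weight k y) *\<^sub>R v k)"
    unfolding scaleR_diff_left using x
    by (intro summable_diff norm_weighted_suminf_le(1)[OF _ _ vM] sums_summable[OF cf_weight_sums_1] cf_weight_nonneg) auto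
  have "d \<longlonglongrightarrow> 0 - 0" unfolding d_def by (intro tendsto_diff cf_tail_tendsto_0)
  then have "(\<lambda>n. l / 4 * \<bar>x - y\<bar> + \<bar>d (Suc n)\<bar> * M) \<longlonglongrightarrow> l / 4 * \<bar>x - y\<bar> + \<bar>0\<bar> * M"
    by (intro tendsto_intros) (simp add: LIMSEQ_Suc)
  moreover have "(\<lambda>n. norm (\<Sum>k<Suc n. (cf_weight k x - cf_weight k y) *\<^sub>R v k)) \<longlonglongrightarrow> norm (\<Sum>k. (cf_weight k x - cf_weight k y) *\<^sub>R v k)"
    by (intro tendsto_norm LIMSEQ_Suc[OF summable_LIMSEQ[OF sm]])
  ultimately show ?thesis
    unfolding v_def[symmetric] using LIMSEQ_le[of _ _ _ "l / 4 * \<bar>x - y\<bar> + \<bar>0\<bar> * M"] part by fastforce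
qed

lemma weighted_lipschitz:
  fixes w :: "real \<Rightarrow> 'a::{real_normed_field,banach}"
  assumes q: "q sums 1" "\<And>k. q k \<ge> 0" "q 0 \<le> 1 / 2" and h: "\<And>k. norm (h k) \<le> 1"
    and lip: "l-lipschitz_on {0..1} w" and x: "x \<in> {0..1}" "y \<in> {0..1}"
  shows "norm (\<Sum>k. q k *\<^sub>R (h k * (w (1 / (real k + 1 + x)) - w (1 / (real k + 1 + y))))) \<le> 5 / 8 * l * \<bar>x - y\<bar>"
proof -
  have l: "l \<ge> 0" using lip by (rule lipschitz_on_nonneg)
  \<comment> \<open>The contraction factor of each branch is moved into its weight. The total mass
    becomes \<open>1/4 + 3/4 * q 0\<close>, at most 5/8, and \<open>v\<close> below is rescaled to
    compensate.\<close>
  define r where "r k = q k * (if k = 0 then 1 else 1 / 4)" for k :: nat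
  have "(\<lambda>k. q k * (1 / 4) + (if k = 0 then 3 / 4 * q 0 else 0)) sums (1 * (1 / 4) + 3 / 4 * q 0)"
    by (intro sums_add sums_mult2 q(1) sums_single)
  moreover have "(\<lambda>k. q k * (1 / 4) + (if k = 0 then 3 / 4 * q 0 else 0)) = r"
    by (auto simp: r_def fun_eq_iff)
  ultimately have r: "r sums (1 / 4 + 3 / 4 * q 0)" by simp
  have le: "norm (w (1 / (real k + 1 + x)) - w (1 / (real k + 1 + y))) \<le> l * ((if k = 0 then 1 else 1 / 4) * \<bar>x - y\<bar>)" for k
  proof -
    have "norm (w (1 / (real k + 1 + x)) - w (1 / (real k + 1 + y))) \<le> l * dist (1 / (real k + 1 + x)) (1 / (real k + 1 + y))"
      unfolding dist_norm[symmetric] by (rule lipschitz_onD[OF lip]) (use x in auto)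
    also have "\<dots> \<le> l * ((if k = 0 then 1 else 1 / 4) * \<bar>x - y\<bar>)"
      unfolding dist_real_def using x l by (intro mult_left_mono inverse_shift_diff_le) auto
    finally show ?thesis .
  qed
  define v where "v k = (if k = 0 then 1 else 4) *\<^sub>R (h k * (w (1 / (real k + 1 + x)) - w (1 / (real k + 1 + y))))" for k
  have v: "norm (v k) \<le> l * \<bar>x - y\<bar>" for k
  proof -
    have "norm (v k) \<le> (if k = 0 then 1 else 4) * (1 * (l * ((if k = 0 then 1 else 1 / 4) * \<bar>x - y\<bar>)))"
      unfolding v_def norm_scaleR norm_mult by (intro mult_mono le h) auto
    then show ?thesis by (auto split: if_splits)
  qed
  have "norm (\<Sum>k. r k *\<^sub>R v k) \<le> l * \<bar>x - y\<bar> * suminf r"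
    by (rule norm_weighted_suminf_le(2)[OF sums_summable[OF r] _ v]) (simp add: r_def q(2))
  also have "\<dots> \<le> l * \<bar>x - y\<bar> * (5 / 8)"
    unfolding sums_unique[OF r, symmetric] using l q(3) by (intro mult_left_mono) auto
  also have "(\<lambda>k. r k *\<^sub>R v k) = (\<lambda>k. q k *\<^sub>R (h k * (w (1 / (real k + 1 + x)) - w (1 / (real k + 1 + y)))))"
    by (auto simp: r_def v_def fun_eq_iff)
  finally show ?thesis by (simp add: mult_ac)
qed

lemma digit_op_summable:
  fixes h :: "nat \<Rightarrow> 'a::{real_normed_field,banach}"
  assumes "(\<lambda>k. q k x) sums 1" "\<And>k. q k x \<ge> 0" "\<And>k. norm (h k) \<le> H" "x \<ge> 0" 
    "\<And>t. t \<in> {0..1} \<Longrightarrow> norm (w t) \<le> M"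
  shows "summable (\<lambda>k. q k x *\<^sub>R (h (Suc k) * w (1 / (real k + 1 + x))))" (is ?A)
    and norm_digit_op_le: "norm (digit_op q h w x) \<le> H * M" (is ?B)
proof -
  have H: "H \<ge> 0" using norm_ge_zero assms(3) by (rule order_trans)
  have "norm (h (Suc k) * w (1 / (real k + 1 + x))) \<le> H * M" for k
    unfolding norm_mult using assms H inverse_shift_in_unit by (intro mult_mono) auto
  from norm_weighted_suminf_le[OF sums_summable[OF assms(1)] assms(2) this] show ?A ?B
    using sums_unique[OF assms(1)] by (auto simp: digit_op_def)
qed

text \<open>Three effects add up. Moving the branches costs 5/8 of \<open>l\<close>. Moving the
  weights with \<open>h\<close> replaced by the constant \<open>z\<close> costs 1/4 of
  \<open>l\<close> by Abel summation. A varying \<open>h\<close> would spoil that summation, so the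
  deviation \<open>h - z\<close> is estimated absolutely and gives the term with \<open>S\<close>.
  For constant \<open>h\<close> this term is absent and a pure contraction by 7/8 remains.\<close>

lemma gauss_op_lipschitz:
  fixes w :: "real \<Rightarrow> 'a::{real_normed_field,banach}"
  assumes h: "\<And>k. norm (h k) \<le> 1" and z: "norm z \<le> 1"
    and lip: "l-lipschitz_on {0..1} w" and M: "\<And>t. t \<in> {0..1} \<Longrightarrow> norm (w t) \<le> M"
    and S: "(\<lambda>k. cf_weight k 0 * norm (h (Suc k) - z)) sums S"
  shows "(7 / 8 * l + 4 * M * S)-lipschitz_on {0..1} (gauss_op h w)"
proof (rule lipschitz_onI)
  have l: "l \<ge> 0" using lip by (rule lipschitz_on_nonneg)
  have M0: "M \<ge> 0" using norm_ge_zero M[of 0] by (rule order_trans) auto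
  have S0: "S \<ge> 0" using S by (rule sums_le[OF _ sums_zero, rotated]) (auto simp: cf_weight_nonneg)
  show "0 \<le> 7 / 8 * l + 4 * M * S" using l M0 S0 by simp
  fix x y :: real assume xy: "x \<in> {0..1}" "y \<in> {0..1}"
  let ?p = "\<lambda>k. cf_weight k x" and ?d = "\<lambda>k. cf_weight k x - cf_weight k y" and ?h = "\<lambda>k. h (Suc k)"
  let ?X = "\<lambda>k. w (1 / (real k + 1 + x))" and ?Y = "\<lambda>k. w (1 / (real k + 1 + y))"
  have X: "norm (?X k) \<le> M" for k by (rule M) (use xy in auto)
  have Y: "norm (?Y k) \<le> M" for k by (rule M) (use xy in auto)
  note sp = sums_summable[OF cf_weight_sums_1]
  have sum_p: "summable (\<lambda>k. cf_weight k t *\<^sub>R v k)" if "t \<in> {0..1}" "\<And>k. norm (v k) \<le> C" for t C and v :: "nat \<Rightarrow> 'a"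
    using that by (intro norm_weighted_suminf_le(1)[OF sp, where M = C] cf_weight_nonneg) auto
  have hX: "norm (?h k * ?X k) \<le> 1 * M" for k
    unfolding norm_mult using h X by (intro mult_mono) auto
  have hY: "norm (?h k * ?Y k) \<le> 1 * M" for k
    unfolding norm_mult using h Y by (intro mult_mono) auto
  have eY: "norm ((?h k - z) * ?Y k) \<le> 2 * M" for k
  proof -
    have "norm (?h k - z) \<le> 2" using norm_triangle_ineq4[of "?h k" z] h[of "Suc k"] z by linarith
    then show ?thesis unfolding norm_mult using Y by (intro mult_mono) auto
  qed
  have s1: "summable (\<lambda>k. ?p k *\<^sub>R (?h k * ?X k))" by (rule sum_p[OF xy(1) hX])
  have s2: "summable (\<lambda>k. ?p k *\<^sub>R (?h k * ?Y k))" by (rule sum_p[OF xy(1) hY])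
  have s3: "summable (\<lambda>k. cf_weight k y *\<^sub>R (?h k * ?Y k))" by (rule sum_p[OF xy(2) hY])
  have s4: "summable (\<lambda>k. ?d k *\<^sub>R ?Y k)"
    unfolding scaleR_diff_left by (intro summable_diff sum_p[OF xy(1) Y] sum_p[OF xy(2) Y])
  have s5: "summable (\<lambda>k. ?d k *\<^sub>R ((?h k - z) * ?Y k))"
    unfolding scaleR_diff_left by (intro summable_diff sum_p[OF xy(1) eY] sum_p[OF xy(2) eY])
  have "gauss_op h w x - gauss_op h w y = (\<Sum>k. ?p k *\<^sub>R (?h k * ?X k)) - (\<Sum>k. ?p k *\<^sub>R (?h k * ?Y k))
      + ((\<Sum>k. ?p k *\<^sub>R (?h k * ?Y k)) - (\<Sum>k. cf_weight k y *\<^sub>R (?h k * ?Y k)))"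
    by (simp add: digit_op_def)
  also have "(\<Sum>k. ?p k *\<^sub>R (?h k * ?X k)) - (\<Sum>k. ?p k *\<^sub>R (?h k * ?Y k)) = (\<Sum>k. ?p k *\<^sub>R (?h k * (?X k - ?Y k)))"
    unfolding suminf_diff[OF s1 s2] by (simp add: algebra_simps)
  also have "(\<Sum>k. ?p k *\<^sub>R (?h k * ?Y k)) - (\<Sum>k. cf_weight k y *\<^sub>R (?h k * ?Y k)) = (\<Sum>k. z * (?d k *\<^sub>R ?Y k) + ?d k *\<^sub>R ((?h k - z) * ?Y k))"
    unfolding suminf_diff[OF s2 s3] by (simp add: algebra_simps)
  also have "\<dots> = z * (\<Sum>k. ?d k *\<^sub>R ?Y k) + (\<Sum>k. ?d k *\<^sub>R ((?h k - z) * ?Y k))"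
    using suminf_add[OF summable_mult[OF s4, of z] s5] suminf_mult[OF s4, of z] by simp
  finally have eq: "gauss_op h w x - gauss_op h w y = (\<Sum>k. ?p k *\<^sub>R (?h k * (?X k - ?Y k)))
     + (z * (\<Sum>k. ?d k *\<^sub>R ?Y k) + (\<Sum>k. ?d k *\<^sub>R ((?h k - z) * ?Y k)))" .
  have "norm (gauss_op h w x - gauss_op h w y) \<le> norm (\<Sum>k. ?p k *\<^sub>R (?h k * (?X k - ?Y k)))
     + (norm z * norm (\<Sum>k. ?d k *\<^sub>R ?Y k) + norm (\<Sum>k. ?d k *\<^sub>R ((?h k - z) * ?Y k)))"
    unfolding eq norm_mult[symmetric]
    by (rule order_trans[OF norm_triangle_ineq add_left_mono[OF norm_triangle_ineq]])
  also have "norm (\<Sum>k. ?p k *\<^sub>R (?h k * (?X k - ?Y k))) \<le> 5 / 8 * l * \<bar>x - y\<bar>"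
    by (rule weighted_lipschitz[OF cf_weight_sums_1 _ _ _ lip xy])
       (use xy h cf_weight_0_le[of x] in \<open>auto intro: cf_weight_nonneg\<close>)
  also have "norm z * norm (\<Sum>k. ?d k *\<^sub>R ?Y k) \<le> 1 * (l / 4 * \<bar>x - y\<bar>)"
    by (intro mult_mono z cf_weight_diff_suminf_le[OF lip xy M]) auto
  also have "norm (\<Sum>k. ?d k *\<^sub>R ((?h k - z) * ?Y k)) \<le> 4 * \<bar>x - y\<bar> * M * S"
  proof -
    have le: "norm (?d k *\<^sub>R ((?h k - z) * ?Y k)) \<le> 4 * \<bar>x - y\<bar> * M * (cf_weight k 0 * norm (?h k - z))" for k
    proof -
      have "norm (?d k *\<^sub>R ((?h k - z) * ?Y k)) \<le> (4 * \<bar>x - y\<bar> * cf_weight k 0) * (norm (?h k - z) * M)"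
        unfolding norm_scaleR norm_mult 
        by (intro mult_mono cf_weight_diff_le Y) (use xy M0 in \<open>auto simp: cf_weight_nonneg\<close>)
      then show ?thesis by (simp add: mult_ac)
    qed
    have r: "summable (\<lambda>k. 4 * \<bar>x - y\<bar> * M * (cf_weight k 0 * norm (?h k - z)))"
      by (intro summable_mult sums_summable[OF S])
    have s: "summable (\<lambda>k. norm (?d k *\<^sub>R ((?h k - z) * ?Y k)))"
      by (rule summable_comparison_test'[OF r, of 0]) (use le in auto)
    have "norm (\<Sum>k. ?d k *\<^sub>R ((?h k - z) * ?Y k)) \<le> (\<Sum>k. norm (?d k *\<^sub>R ((?h k - z) * ?Y k)))"
      by (rule summable_norm[OF s])
    also have "\<dots> \<le> (\<Sum>k. 4 * \<bar>x - y\<bar> * M * (cf_weight k 0 * norm (?h k - z)))"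
      by (rule suminf_le[OF le s r])
    also have "\<dots> = 4 * \<bar>x - y\<bar> * M * S"
      using suminf_mult[OF sums_summable[OF S]] sums_unique[OF S] by simp
    finally show ?thesis .
  qed
  finally show "dist (gauss_op h w x) (gauss_op h w y) \<le> (7 / 8 * l + 4 * M * S) * dist x y"
    by (simp add: dist_norm algebra_simps)
qed

subsection \<open>Decay of the weighted transfer operator\<close>

lemma norm_gauss_op_funpow_le:
  fixes w :: "real \<Rightarrow> 'a::{real_normed_field,banach}"
  assumes "\<And>k. norm (h k) \<le> 1" "\<And>t. t \<in> {0..1} \<Longrightarrow> norm (w t) \<le> M" "x \<in> {0..1}"
  shows "norm ((gauss_op h ^^ m) w x) \<le> M"
  using assms(3)
proof (induction m arbitrary: x)
  case (Suc m)
  have "norm (gauss_op h ((gauss_op h ^^ m) w) x) \<le> 1 * M"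
    by (rule norm_digit_op_le[OF cf_weight_sums_1 _ assms(1) _ Suc.IH])
       (use Suc.prems in \<open>auto simp: cf_weight_nonneg\<close>)
  then show ?case by simp
qed (use assms in auto)

lemma norm_iid_op_funpow_le:
  fixes w :: "real \<Rightarrow> 'a::{real_normed_field,banach}"
  assumes "\<And>k. norm (h k) \<le> 1" "\<And>t. t \<in> {0..1} \<Longrightarrow> norm (w t) \<le> M" "x \<in> {0..1}"
  shows "norm ((iid_op h ^^ m) w x) \<le> M"
  using assms(3)
proof (induction m arbitrary: x)
  case (Suc m)
  have "norm (iid_op h ((iid_op h ^^ m) w) x) \<le> 1 * M"
    by (rule norm_digit_op_le[OF cf_weight_sums_1 _ assms(1) _ Suc.IH])
       (use Suc.prems in \<open>auto simp: cf_weight_nonneg\<close>)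
  then show ?case by simp
qed (use assms in auto)

text \<open>Frozen weights do not vary with \<open>x\<close>, so only the branches contribute and no
  term in the sup norm of \<open>w\<close> is created. The iterates thus become flat at a geometric
  rate, whatever \<open>h\<close> is.\<close>

lemma iid_op_lipschitz:
  fixes w :: "real \<Rightarrow> 'a::{real_normed_field,banach}"
  assumes h: "\<And>k. norm (h k) \<le> 1" and M: "\<And>t. t \<in> {0..1} \<Longrightarrow> norm (w t) \<le> M"
    and lip: "l-lipschitz_on {0..1} w"
  shows "(5 / 8 * l)-lipschitz_on {0..1} (iid_op h w)"
proof (rule lipschitz_onI)
  have l: "l \<ge> 0" using lip by (rule lipschitz_on_nonneg)
  then show "0 \<le> 5 / 8 * l" by simp
  fix x y :: real assume xy: "x \<in> {0..1}" "y \<in> {0..1}"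
  have s: "summable (\<lambda>k. cf_weight k 0 *\<^sub>R (h (Suc k) * w (1 / (real k + 1 + t))))" if "t \<in> {0..1}" for t
    by (rule digit_op_summable[where q = "\<lambda>k _. cf_weight k 0", OF cf_weight_sums_1 _ h _ M])
       (use that in \<open>auto simp: cf_weight_nonneg\<close>)
  have "iid_op h w x - iid_op h w y = (\<Sum>k. cf_weight k 0 *\<^sub>R (h (Suc k) * (w (1 / (real k + 1 + x)) - w (1 / (real k + 1 + y)))))"
    unfolding digit_op_def suminf_diff[OF s[OF xy(1)] s[OF xy(2)]] by (simp add: algebra_simps)
  also have "norm \<dots> \<le> 5 / 8 * l * \<bar>x - y\<bar>"
    by (rule weighted_lipschitz[OF cf_weight_sums_1 _ _ h lip xy])
       (use cf_weight_0_le[of 0] in \<open>auto simp: cf_weight_nonneg\<close>)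
  finally show "dist (iid_op h w x) (iid_op h w y) \<le> 5 / 8 * l * dist x y"
    by (simp add: dist_norm)
qed

lemma iid_op_funpow_lipschitz:
  fixes w :: "real \<Rightarrow> 'a::{real_normed_field,banach}"
  assumes h: "\<And>k. norm (h k) \<le> 1" and M: "\<And>t. t \<in> {0..1} \<Longrightarrow> norm (w t) \<le> M"
    and lip: "l-lipschitz_on {0..1} w"
  shows "((5 / 8) ^ m * l)-lipschitz_on {0..1} ((iid_op h ^^ m) w)"
proof (induction m)
  case (Suc m)
  have "(5 / 8 * ((5 / 8) ^ m * l))-lipschitz_on {0..1} (iid_op h ((iid_op h ^^ m) w))"
    by (rule iid_op_lipschitz[OF h norm_iid_op_funpow_le[OF h M] Suc.IH])
  then show ?case by (simp add: mult.assoc)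
qed (use lip in simp)

lemma gauss_op_iid_op_diff:
  fixes w :: "real \<Rightarrow> 'a::{real_normed_field,banach}"
  assumes h: "\<And>k. norm (h k) \<le> 1" and M: "\<And>t. t \<in> {0..1} \<Longrightarrow> norm (w t) \<le> M" and "x \<in> {0..1}"
  shows "norm ((gauss_op h ^^ m) w x - (1 / 2) ^ m *\<^sub>R (iid_op h ^^ m) w x) \<le> (1 - (1 / 2) ^ m) * M"
  using assms(3)
proof (induction m arbitrary: x)
  case (Suc m)
  let ?A = "(gauss_op h ^^ m) w" and ?B = "(iid_op h ^^ m) w"
  define y where "y k = 1 / (real k + 1 + x)" for k
  have y: "y k \<in> {0..1}" for k using Suc.prems by (auto simp: y_def)
  have M0: "M \<ge> 0" using norm_ge_zero M[of 0] by (rule order_trans) auto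
  have A: "norm (?A t) \<le> M" if "t \<in> {0..1}" for t by (rule norm_gauss_op_funpow_le[OF h M that])
  have B: "norm (?B t) \<le> M" if "t \<in> {0..1}" for t by (rule norm_iid_op_funpow_le[OF h M that])
  have hA: "norm (h (Suc k) * ?A (y k)) \<le> M" for k
    using mult_mono[OF h A[OF y]] M0 by (simp add: norm_mult)
  have sA: "summable (\<lambda>k. cf_weight k x *\<^sub>R (h (Suc k) * ?A (y k)))"
    unfolding y_def using Suc.prems
    by (intro digit_op_summable[where q = cf_weight, OF cf_weight_sums_1 _ h _ A]) (auto simp: cf_weight_nonneg)
  have sB: "summable (\<lambda>k. cf_weight k 0 *\<^sub>R (h (Suc k) * ?B (y k)))"
    unfolding y_def using Suc.prems
    by (intro digit_op_summable[where q = "\<lambda>k _. cf_weight k 0", OF cf_weight_sums_1 _ h _ B]) (auto simp: cf_weight_nonneg)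
  have q1: "(\<lambda>k. cf_weight k x - cf_weight k 0 / 2) sums (1 - 1 / 2)"
    using Suc.prems by (intro sums_diff sums_divide cf_weight_sums_1) auto
  have q1': "cf_weight k x - cf_weight k 0 / 2 \<ge> 0" for k using cf_weight_ge[OF Suc.prems] by simp
  have q2: "(\<lambda>k. cf_weight k 0 / 2) sums (1 / 2)" by (intro sums_divide cf_weight_sums_1) auto
  have hAB: "norm (h (Suc k) * (?A (y k) - (1 / 2) ^ m *\<^sub>R ?B (y k))) \<le> (1 - (1 / 2) ^ m) * M" for k
    using mult_mono[OF h Suc.IH[OF y]] by (simp add: norm_mult)
  note s1 = norm_weighted_suminf_le[OF sums_summable[OF q1] q1' hA]
  have q2': "cf_weight k 0 / 2 \<ge> 0" for k by (simp add: cf_weight_nonneg)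
  note s2 = norm_weighted_suminf_le[OF sums_summable[OF q2] q2' hAB]
  have "(gauss_op h ^^ Suc m) w x - (1 / 2) ^ Suc m *\<^sub>R (iid_op h ^^ Suc m) w x
     = (\<Sum>k. cf_weight k x *\<^sub>R (h (Suc k) * ?A (y k))) - (1 / 2) ^ Suc m *\<^sub>R (\<Sum>k. cf_weight k 0 *\<^sub>R (h (Suc k) * ?B (y k)))"
    by (simp add: digit_op_def y_def)
  also have "\<dots> = (\<Sum>k. cf_weight k x *\<^sub>R (h (Suc k) * ?A (y k)) - (1 / 2) ^ Suc m *\<^sub>R (cf_weight k 0 *\<^sub>R (h (Suc k) * ?B (y k))))"
    by (subst suminf_diff[OF sA summable_scaleR_right[OF sB], symmetric]) (simp add: suminf_scaleR_right[OF sB])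
  also have "\<dots> = (\<Sum>k. (cf_weight k x - cf_weight k 0 / 2) *\<^sub>R (h (Suc k) * ?A (y k)) + (cf_weight k 0 / 2) *\<^sub>R (h (Suc k) * (?A (y k) - (1 / 2) ^ m *\<^sub>R ?B (y k))))"
    by (simp add: algebra_simps)
  also have "\<dots> = (\<Sum>k. (cf_weight k x - cf_weight k 0 / 2) *\<^sub>R (h (Suc k) * ?A (y k))) + (\<Sum>k. (cf_weight k 0 / 2) *\<^sub>R (h (Suc k) * (?A (y k) - (1 / 2) ^ m *\<^sub>R ?B (y k))))"
    by (rule suminf_add[OF s1(1) s2(1), symmetric])
  also have "norm \<dots> \<le> M * (1 - 1 / 2) + (1 - (1 / 2) ^ m) * M * (1 / 2)"
    using s1(2) s2(2) unfolding sums_unique[OF q1, symmetric] sums_unique[OF q2, symmetric]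
    by (rule norm_triangle_mono)
  finally show ?case by (simp add: algebra_simps)
qed simp

text \<open>Here \<open>V\<close> is the variance of \<open>h\<close> under mu, that is, the second
  moment (at most 1) minus the square of the modulus of the mean. The inequality
  \<open>S^2 <= V\<close> is Cauchy-Schwarz, obtained by expanding the weighted sum of the squares
  of \<open>norm (h - z) - S\<close>.\<close>

lemma digit_variance:
  fixes h :: "nat \<Rightarrow> complex"
  assumes h: "\<And>k. norm (h k) \<le> 1" and z: "(\<lambda>k. cf_weight k 0 *\<^sub>R h (Suc k)) sums z"
  obtains V S where "(\<lambda>k. cf_weight k 0 * (norm (h (Suc k) - z))\<^sup>2) sums V" "V \<le> 1 - (norm z)\<^sup>2"
    "(\<lambda>k. cf_weight k 0 * norm (h (Suc k) - z)) sums S" "S\<^sup>2 \<le> V"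
proof -
  let ?m = "\<lambda>k. cf_weight k 0" and ?h = "\<lambda>k. h (Suc k)"
  have m: "?m sums 1" by (rule cf_weight_sums_1) simp
  have m0: "?m k \<ge> 0" for k by (simp add: cf_weight_nonneg)
  have sr: "summable (\<lambda>k. ?m k * v k)" if "\<And>k. norm (v k) \<le> C" for v :: "nat \<Rightarrow> real" and C
    using norm_weighted_suminf_le(1)[OF sums_summable[OF m] m0 that] by simp
  have h2: "norm ((norm (h k))\<^sup>2) \<le> 1" for k using h[of k] by (simp add: power_le_one)
  obtain Q where Q: "(\<lambda>k. ?m k * (norm (?h k))\<^sup>2) sums Q" using sr[OF h2] by (auto simp: summable_def)
  have Q1: "Q \<le> 1" by (rule sums_le[OF _ Q m]) (use h2 m0 in \<open>simp add: mult_left_le\<close>)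
  have zz: "Re (z * cnj z) = (norm z)\<^sup>2" unfolding cmod_power2 by (simp add: power2_eq_square)
  have "(\<lambda>k. Re ((?m k *\<^sub>R ?h k) * cnj z)) sums Re (z * cnj z)"
    by (intro sums_Re sums_mult2 z)
  then have R: "(\<lambda>k. ?m k * Re (?h k * cnj z)) sums (norm z)\<^sup>2"
    unfolding zz mult_scaleR_left by simp
  have "(\<lambda>k. ?m k * (norm (?h k))\<^sup>2 + ?m k * (norm z)\<^sup>2 - 2 * (?m k * Re (?h k * cnj z))) sums (Q + 1 * (norm z)\<^sup>2 - 2 * (norm z)\<^sup>2)"
    by (intro sums_diff sums_add sums_mult sums_mult2 Q m R)
  moreover have "?m k * (norm (?h k))\<^sup>2 + ?m k * (norm z)\<^sup>2 - 2 * (?m k * Re (?h k * cnj z)) = ?m k * (norm (?h k - z))\<^sup>2" for k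
  proof -
    have "(norm (?h k - z))\<^sup>2 = (norm (?h k))\<^sup>2 + (norm z)\<^sup>2 - 2 * Re (?h k * cnj z)"
      unfolding cmod_power2 by (simp add: power2_eq_square algebra_simps)
    then show ?thesis by (simp only:) (simp add: ring_distribs mult_ac)
  qed
  ultimately have V: "(\<lambda>k. ?m k * (norm (?h k - z))\<^sup>2) sums (Q - (norm z)\<^sup>2)" by simp
  have "norm (norm (?h k - z)) \<le> 1 + norm z" for k
    using norm_triangle_ineq4[of "?h k" z] h[of "Suc k"] by simp
  from sr[of "\<lambda>k. norm (?h k - z)", OF this] obtain S where S: "(\<lambda>k. ?m k * norm (?h k - z)) sums S" by (auto simp: summable_def)
  have "(\<lambda>k. ?m k * (norm (?h k - z))\<^sup>2 - 2 * S * (?m k * norm (?h k - z)) + ?m k * S\<^sup>2) sums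
     ((Q - (norm z)\<^sup>2) - 2 * S * S + 1 * S\<^sup>2)"
    by (intro sums_add sums_diff sums_mult sums_mult2 V S m)
  moreover have "?m k * (norm (?h k - z))\<^sup>2 - 2 * S * (?m k * norm (?h k - z)) + ?m k * S\<^sup>2 = ?m k * (norm (?h k - z) - S)\<^sup>2" for k
    by (simp add: power2_eq_square algebra_simps)
  ultimately have "(\<lambda>k. ?m k * (norm (?h k - z) - S)\<^sup>2) sums ((Q - (norm z)\<^sup>2) - S\<^sup>2)"
    by (simp add: power2_eq_square)
  then have "0 \<le> (Q - (norm z)\<^sup>2) - S\<^sup>2"
    by (rule sums_le[OF _ sums_zero, rotated]) (use m0 in auto)
  then show ?thesis using that[OF V _ S] Q1 by linarith
qed

section \<open>Mean and spread of a digit function under mu\<close>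

definition digit_mean :: "(nat \<Rightarrow> complex) \<Rightarrow> complex" where
  "digit_mean h = (\<Sum>k. cf_weight k 0 *\<^sub>R h (Suc k))"

text \<open>The quantity D of the overview. If all values of \<open>h\<close> have modulus one, it
  is exactly the variance of \<open>h\<close> under mu; in general it bounds that variance from
  above.\<close>

definition digit_spread :: "(nat \<Rightarrow> complex) \<Rightarrow> real" where
  "digit_spread h = 1 - (norm (digit_mean h))\<^sup>2"

lemma digit_mean_sums:
  assumes h: "\<And>k. norm (h k) \<le> 1"
  shows "(\<lambda>k. cf_weight k 0 *\<^sub>R h (Suc k)) sums digit_mean h" "norm (digit_mean h) \<le> 1"
proof -
  have m: "(\<lambda>k. cf_weight k 0) sums 1" by (rule cf_weight_sums_1) simp
  have m0: "cf_weight k 0 \<ge> 0" for k by (simp add: cf_weight_nonneg)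
  note * = norm_weighted_suminf_le[OF sums_summable[OF m] m0, of "\<lambda>k. h (Suc k)", OF h]
  show "(\<lambda>k. cf_weight k 0 *\<^sub>R h (Suc k)) sums digit_mean h"
    unfolding digit_mean_def by (rule summable_sums[OF *(1)])
  show "norm (digit_mean h) \<le> 1" using *(2) sums_unique[OF m] by (simp add: digit_mean_def)
qed

lemma digit_spread_bounds:
  assumes "\<And>k. norm (h k) \<le> 1"
  shows "0 \<le> digit_spread h" "digit_spread h \<le> 1"
  using digit_mean_sums(2)[OF assms] by (auto simp: digit_spread_def abs_square_le_1)

lemma digit_spread_sums:
  assumes h: "\<And>k. norm (h k) \<le> 1"
  obtains S where "(\<lambda>k. cf_weight k 0 * norm (h (Suc k) - digit_mean h)) sums S" "S \<le> sqrt (digit_spread h)"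
proof -
  obtain V S where VS: "V \<le> 1 - (norm (digit_mean h))\<^sup>2" "(\<lambda>k. cf_weight k 0 * norm (h (Suc k) - digit_mean h)) sums S" "S\<^sup>2 \<le> V"
    by (rule digit_variance[of h, OF h digit_mean_sums(1)[of h, OF h]]) blast
  have "S \<le> sqrt (digit_spread h)" using VS by (intro real_le_rsqrt) (simp add: digit_spread_def)
  then show ?thesis by (rule that[OF VS(2)])
qed

text \<open>Centering $h$ at its mean makes the error term $\sqrt D$ times the oscillation of $w$.  As this
  oscillation is itself of order $\sqrt D$, the error is a small multiple of $D$.\<close>
lemma norm_iid_op_le:
  fixes w :: "real \<Rightarrow> complex"
  assumes h: "\<And>k. norm (h k) \<le> 1" and M: "\<And>t. t \<in> {0..1} \<Longrightarrow> norm (w t) \<le> M"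
    and lip: "l-lipschitz_on {0..1} w" and x: "x \<in> {0..1}"
  shows "norm (iid_op h w x) \<le> (1 - digit_spread h / 2) * M + sqrt (digit_spread h) * l"
proof -
  let ?m = "\<lambda>k. cf_weight k 0" and ?h = "\<lambda>k. h (Suc k)" and ?z = "digit_mean h"
  let ?w = "\<lambda>k. w (1 / (real k + 1 + x))"
  have l: "l \<ge> 0" using lip by (rule lipschitz_on_nonneg)
  have M0: "M \<ge> 0" using norm_ge_zero M[of 0] by (rule order_trans) auto
  have m: "?m sums 1" by (rule cf_weight_sums_1) simp
  have m0: "?m k \<ge> 0" for k by (simp add: cf_weight_nonneg)
  obtain S where S: "(\<lambda>k. ?m k * norm (?h k - ?z)) sums S" "S \<le> sqrt (digit_spread h)"
    by (rule digit_spread_sums[OF h])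
  have wM: "norm (?w k) \<le> M" for k by (rule M) (use x in auto)
  note s1 = norm_weighted_suminf_le[OF sums_summable[OF m] m0 wM]
  have le: "norm (?m k *\<^sub>R ((?h k - ?z) * (?w k - w 0))) \<le> l * (?m k * norm (?h k - ?z))" for k
  proof -
    have "norm (?w k - w 0) \<le> l * dist (1 / (real k + 1 + x)) 0"
      unfolding dist_norm[symmetric] by (rule lipschitz_onD[OF lip]) (use x in auto)
    also have "\<dots> \<le> l * 1" using l x by (intro mult_left_mono) auto
    finally have "norm (?m k *\<^sub>R ((?h k - ?z) * (?w k - w 0))) \<le> ?m k * (norm (?h k - ?z) * l)"
      unfolding norm_scaleR norm_mult using m0[of k] by (intro mult_mono) auto
    then show ?thesis by (simp add: mult_ac)
  qed
  have sl: "(\<lambda>k. l * (?m k * norm (?h k - ?z))) sums (l * S)" by (intro sums_mult S)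
  have sn: "summable (\<lambda>k. norm (?m k *\<^sub>R ((?h k - ?z) * (?w k - w 0))))"
    by (rule summable_comparison_test'[OF sums_summable[OF sl], of 0]) (use le in auto)
  have s2: "summable (\<lambda>k. ?m k *\<^sub>R ((?h k - ?z) * (?w k - w 0)))" using sn by (rule summable_norm_cancel)
  have b2: "norm (\<Sum>k. ?m k *\<^sub>R ((?h k - ?z) * (?w k - w 0))) \<le> l * S"
    using order_trans[OF summable_norm[OF sn] suminf_le[OF le sn sums_summable[OF sl]]] sums_unique[OF sl] by simp
  have "(\<lambda>k. (?m k *\<^sub>R ?h k - ?m k *\<^sub>R ?z) * w 0) sums ((?z - 1 *\<^sub>R ?z) * w 0)"
    by (intro sums_mult2 sums_diff digit_mean_sums(1)[OF h] sums_scaleR_left m)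
  then have s0: "(\<lambda>k. ?m k *\<^sub>R ((?h k - ?z) * w 0)) sums 0" by (simp add: algebra_simps)
  have "(\<lambda>k. ?z * (?m k *\<^sub>R ?w k) + ?m k *\<^sub>R ((?h k - ?z) * (?w k - w 0)) + ?m k *\<^sub>R ((?h k - ?z) * w 0)) sums
    (?z * (\<Sum>k. ?m k *\<^sub>R ?w k) + (\<Sum>k. ?m k *\<^sub>R ((?h k - ?z) * (?w k - w 0))) + 0)"
    by (intro sums_add sums_mult summable_sums s1(1) s2 s0)
  moreover have "(\<lambda>k. ?z * (?m k *\<^sub>R ?w k) + ?m k *\<^sub>R ((?h k - ?z) * (?w k - w 0)) + ?m k *\<^sub>R ((?h k - ?z) * w 0))
     = (\<lambda>k. ?m k *\<^sub>R (?h k * ?w k))"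
    by (auto simp: fun_eq_iff algebra_simps)
  ultimately have e: "iid_op h w x = ?z * (\<Sum>k. ?m k *\<^sub>R ?w k) + (\<Sum>k. ?m k *\<^sub>R ((?h k - ?z) * (?w k - w 0)))"
    unfolding digit_op_def by (simp add: sums_iff)
  have zle: "norm ?z \<le> 1 - digit_spread h / 2"
  proof (rule power2_le_imp_le)
    have "(1 - digit_spread h / 2)\<^sup>2 = (norm ?z)\<^sup>2 + (digit_spread h)\<^sup>2 / 4"
      by (simp add: digit_spread_def power2_eq_square algebra_simps)
    then show "(norm ?z)\<^sup>2 \<le> (1 - digit_spread h / 2)\<^sup>2" by simp
    show "0 \<le> 1 - digit_spread h / 2" using digit_spread_bounds[of h, OF h] by linarith
  qed
  have "norm (iid_op h w x) \<le> norm ?z * norm (\<Sum>k. ?m k *\<^sub>R ?w k) + norm (\<Sum>k. ?m k *\<^sub>R ((?h k - ?z) * (?w k - w 0)))"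
    unfolding e norm_mult[symmetric] by (rule norm_triangle_ineq)
  also have "\<dots> \<le> (1 - digit_spread h / 2) * (M * 1) + l * S"
  proof (intro add_mono mult_mono zle b2)
    show "norm (\<Sum>k. ?m k *\<^sub>R ?w k) \<le> M * 1" using s1(2) sums_unique[OF m] by simp
    show "0 \<le> 1 - digit_spread h / 2" using zle norm_ge_zero[of ?z] by linarith
  qed simp
  also have "\<dots> \<le> (1 - digit_spread h / 2) * M + sqrt (digit_spread h) * l"
    using S(2) l mult_left_mono[of S "sqrt (digit_spread h)" l] by (simp add: mult.commute)
  finally show ?thesis .
qed

text \<open>The factor 64 makes the Lipschitz part invariant with room to spare: $7/8 \cdot 64 + 4 = 60$.
  It also fixes the exponent 13 below, because $64\,(5/8)^{12} \le 1/4$.\<close>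
definition controlled :: "real \<Rightarrow> real \<Rightarrow> (real \<Rightarrow> complex) \<Rightarrow> bool" where
  "controlled D N g \<longleftrightarrow> (\<forall>t\<in>{0..1}. norm (g t) \<le> N) \<and> (64 * sqrt D * N)-lipschitz_on {0..1} g"

text \<open>The sharper constant 60 is kept as a separate claim because the gap between 60 and 64 is
  spent later: when the sup bound \<open>N\<close> shrinks, the Lipschitz bound has to hold relative
  to the smaller \<open>N\<close>.\<close>

lemma controlled_gauss_op:
  assumes h: "\<And>k. norm (h k) \<le> 1" and g: "controlled (digit_spread h) N g"
  shows "(60 * sqrt (digit_spread h) * N)-lipschitz_on {0..1} (gauss_op h g)"
    and "controlled (digit_spread h) N (gauss_op h g)"
proof -
  let ?D = "digit_spread h"
  have N: "norm (g t) \<le> N" if "t \<in> {0..1}" for t using g that by (auto simp: controlled_def)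
  have N0: "N \<ge> 0" using norm_ge_zero N[of 0] by (rule order_trans) auto
  obtain S where S: "(\<lambda>k. cf_weight k 0 * norm (h (Suc k) - digit_mean h)) sums S" "S \<le> sqrt ?D"
    by (rule digit_spread_sums[OF h])
  have "(7 / 8 * (64 * sqrt ?D * N) + 4 * N * S)-lipschitz_on {0..1} (gauss_op h g)"
    by (rule gauss_op_lipschitz[OF h digit_mean_sums(2)[OF h] _ N S(1)]) (use g in \<open>auto simp: controlled_def\<close>)
  moreover have "7 / 8 * (64 * sqrt ?D * N) + 4 * N * S \<le> 60 * sqrt ?D * N"
    using mult_left_mono[OF S(2) N0] by (simp add: mult.commute)
  ultimately show l: "(60 * sqrt ?D * N)-lipschitz_on {0..1} (gauss_op h g)"
    by (rule lipschitz_on_le)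
  have "60 * sqrt ?D * N \<le> 64 * sqrt ?D * N"
    using N0 digit_spread_bounds[OF h] by (intro mult_right_mono) auto
  with l have "(64 * sqrt ?D * N)-lipschitz_on {0..1} (gauss_op h g)" by (rule lipschitz_on_le)
  then show "controlled ?D N (gauss_op h g)"
    using norm_gauss_op_funpow_le[of h g N _ 1, OF h N] by (auto simp: controlled_def)
qed

lemma controlled_gauss_op_funpow:
  assumes "\<And>k. norm (h k) \<le> 1" "controlled (digit_spread h) N g"
  shows "controlled (digit_spread h) N ((gauss_op h ^^ m) g)"
  by (induction m) (auto simp: assms(2) intro: controlled_gauss_op(2)[OF assms(1)])

text \<open>The denominator is \<open>2^13 * 4\<close>. The iterate of \<open>iid_op\<close> gains
  D/2 from the modulus of the mean and loses at most D/4 through the oscillation of its argument; it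
  enters \<open>gauss_op ^^ 13\<close> with mass \<open>(1/2)^13\<close>.\<close>

lemma controlled_gauss_op_13:
  assumes h: "\<And>k. norm (h k) \<le> 1" and g: "controlled (digit_spread h) N g"
  shows "controlled (digit_spread h) ((1 - digit_spread h / 2 ^ 15) * N) ((gauss_op h ^^ 13) g)"
proof -
  let ?D = "digit_spread h"
  have D: "0 \<le> ?D" "?D \<le> 1" using digit_spread_bounds[OF h] by auto
  have N: "norm (g t) \<le> N" if "t \<in> {0..1}" for t using g that by (auto simp: controlled_def)
  have N0: "N \<ge> 0" using norm_ge_zero N[of 0] by (rule order_trans) auto
  have lip: "(64 * sqrt ?D * N)-lipschitz_on {0..1} g" using g by (simp add: controlled_def)
  have s12: "(gauss_op h ^^ 13) g = gauss_op h ((gauss_op h ^^ 12) g)" 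
    by (metis comp_apply funpow.simps(2) eval_nat_numeral(3) semiring_norm(26) semiring_norm(27))
  have "(60 * sqrt ?D * N)-lipschitz_on {0..1} ((gauss_op h ^^ 13) g)"
    unfolding s12 by (rule controlled_gauss_op(1)[OF h controlled_gauss_op_funpow[OF h g]])
  moreover have "60 * (sqrt ?D * N) \<le> (64 * (1 - ?D / 2 ^ 15)) * (sqrt ?D * N)"
    using D N0 by (intro mult_right_mono) auto
  ultimately have L: "(64 * sqrt ?D * ((1 - ?D / 2 ^ 15) * N))-lipschitz_on {0..1} ((gauss_op h ^^ 13) g)"
    by (elim lipschitz_on_le) (simp add: mult_ac)
  have "norm ((gauss_op h ^^ 13) g x) \<le> (1 - ?D / 2 ^ 15) * N" if x: "x \<in> {0..1}" for x
  proof -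
    \<comment> \<open>The twelve inner steps flatten the function, and only the outermost step is
      used to gain from the mean.\<close>
    have k12: "(iid_op h ^^ 13) g = iid_op h ((iid_op h ^^ 12) g)"
      by (metis comp_apply funpow.simps(2) eval_nat_numeral(3) semiring_norm(26) semiring_norm(27))
    have "norm ((iid_op h ^^ 13) g x) \<le> (1 - ?D / 2) * N + sqrt ?D * ((5 / 8) ^ 12 * (64 * sqrt ?D * N))"
      unfolding k12 by (rule norm_iid_op_le[OF h norm_iid_op_funpow_le[OF h N] iid_op_funpow_lipschitz[OF h N lip] x])
    also have "sqrt ?D * ((5 / 8) ^ 12 * (64 * sqrt ?D * N)) = ((5 / 8) ^ 12 * 64) * ((sqrt ?D * sqrt ?D) * N)"
      by (simp only: mult_ac)
    also have "\<dots> = ((5 / 8) ^ 12 * 64) * (?D * N)"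
      using D by simp
    also have "\<dots> \<le> 1 / 4 * (?D * N)"
      using D N0 by (intro mult_right_mono) (auto simp: power_divide)
    finally have K: "norm ((iid_op h ^^ 13) g x) \<le> (1 - ?D / 4) * N" by (simp add: algebra_simps)
    have tri: "norm a \<le> norm (a - b) + norm b" for a b :: complex
      using norm_triangle_ineq[of "a - b" b] by simp
    have "norm ((gauss_op h ^^ 13) g x) \<le> norm ((gauss_op h ^^ 13) g x - (1 / 2) ^ 13 *\<^sub>R (iid_op h ^^ 13) g x) + norm ((1 / 2 :: real) ^ 13 *\<^sub>R (iid_op h ^^ 13) g x)"
      by (rule tri)
    also have "\<dots> \<le> (1 - (1 / 2) ^ 13) * N + (1 / 2) ^ 13 * ((1 - ?D / 4) * N)"
      using K by (intro add_mono gauss_op_iid_op_diff[OF h N x]) simp_all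
    also have "\<dots> = (1 - ?D / 2 ^ 15) * N"
      by (simp add: field_simps)
    finally show ?thesis .
  qed
  with L show ?thesis by (auto simp: controlled_def)
qed

lemma norm_gauss_op_funpow_1_le:
  assumes h: "\<And>k. norm (h k) \<le> 1" and x: "x \<in> {0..1}"
  shows "norm ((gauss_op h ^^ n) (\<lambda>_. 1 :: complex) x) \<le> (1 - digit_spread h / 2 ^ 15) ^ (n div 13)"
proof -
  let ?r = "1 - digit_spread h / 2 ^ 15"
  have c: "controlled (digit_spread h) (?r ^ m) ((gauss_op h ^^ (13 * m)) (\<lambda>_. 1))" for m
  proof (induction m)
    case 0
    \<comment> \<open>The constant 1 has Lipschitz constant 0, so control starts with
      \<open>N = 1\<close> for every value of the spread.\<close>
    show ?case using digit_spread_bounds[OF h] by (auto simp: controlled_def lipschitz_on_def)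
  next
    case (Suc m)
    have "13 * Suc m = 13 + 13 * m" by simp
    then show ?case using controlled_gauss_op_13[OF h Suc.IH] by (simp only: funpow_add comp_apply power_Suc)
  qed
  \<comment> \<open>The leftover \<open>n mod 13\<close> steps are applied last; they bring no gain
    but preserve the control already reached.\<close>
  have "n = n mod 13 + 13 * (n div 13)" by simp
  then have e: "gauss_op h ^^ n = (gauss_op h ^^ (n mod 13)) \<circ> (gauss_op h ^^ (13 * (n div 13)))"
    by (metis funpow_add)
  have "controlled (digit_spread h) (?r ^ (n div 13)) ((gauss_op h ^^ n) (\<lambda>_. 1))"
    unfolding e comp_apply by (rule controlled_gauss_op_funpow[OF h c])
  then show ?thesis using x by (auto simp: controlled_def)
qed

subsection \<open>The transfer operator of the Gauss map\<close>

lemma space_gauss_measure: "space gauss_measure = {0<..1}"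
  by (simp add: gauss_measure_def space_restrict_space)

lemma sets_gauss_measure [measurable_cong]: "sets gauss_measure = sets (restrict_space borel {0<..1})"
  unfolding gauss_measure_def sets_density by (rule sets_restrict_space_cong) simp

interpretation gauss: prob_space gauss_measure
  by (rule prob_space_gauss_measure)

lemma measurable_gauss_measureI [measurable (raw)]: "f \<in> borel \<rightarrow>\<^sub>M N \<Longrightarrow> f \<in> gauss_measure \<rightarrow>\<^sub>M N"
  by (simp cong: measurable_cong_sets add: sets_gauss_measure measurable_restrict_space1)

lemma nn_integral_gauss_measure:
  assumes [measurable]: "F \<in> borel_measurable borel"
  shows "(\<integral>\<^sup>+x. F x \<partial>gauss_measure) = (\<integral>\<^sup>+x. F x * ennreal (1 / (ln 2 * (1 + x))) * indicator {0<..1} x \<partial>lborel)"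
proof -
  have "(\<integral>\<^sup>+x. F x \<partial>gauss_measure) = (\<integral>\<^sup>+x. ennreal (1 / (ln 2 * (1 + x))) * F x \<partial>restrict_space lborel {0<..1})"
    unfolding gauss_measure_def by (rule nn_integral_density) (auto intro!: measurable_restrict_space1)
  also have "\<dots> = (\<integral>\<^sup>+x. ennreal (1 / (ln 2 * (1 + x))) * F x * indicator {0<..1} x \<partial>lborel)"
    by (subst nn_integral_restrict_space) auto
  finally show ?thesis by (simp add: mult_ac)
qed

text \<open>The endpoint 1 has to be removed because the branch point \<open>1 / (k + 1 + y)\<close>
  has first digit \<open>k + 2\<close> and image 0 under the Gauss map when
  \<open>y = 1\<close>.\<close>

lemma AE_gauss_measure_unit: "AE x in gauss_measure. x \<in> {0<..<1}"
proof -
  have "emeasure gauss_measure {1} = (\<integral>\<^sup>+x. indicator {1} x \<partial>gauss_measure)"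
    by (rule nn_integral_indicator[symmetric]) (simp add: sets_gauss_measure sets_restrict_space_iff)
  also have "\<dots> = (\<integral>\<^sup>+x. indicator {1} x * ennreal (1 / (ln 2 * (1 + x))) * indicator {0<..1} x \<partial>lborel)"
    by (rule nn_integral_gauss_measure) simp
  also have "\<dots> = (\<integral>\<^sup>+x. 0 \<partial>(lborel :: real measure))"
    by (intro nn_integral_cong_AE) (use AE_lborel_singleton[of "1::real"] in \<open>auto simp: indicator_def elim!: eventually_mono\<close>)
  finally have "AE x in gauss_measure. x \<notin> {1}"
    by (intro AE_not_in) (auto simp: null_sets_def sets_gauss_measure sets_restrict_space_iff)
  moreover have "AE x in gauss_measure. x \<in> {0<..1}"
    using AE_space[of gauss_measure] by (simp add: space_gauss_measure)
  ultimately show ?thesis by eventually_elim auto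
qed

section \<open>Change of variables on the cylinders of the first digit\<close>

lemma cf_weight_measurable [measurable]: "cf_weight k \<in> borel_measurable borel"
  unfolding cf_weight_def[abs_def] by measurable

text \<open>Under \<open>x = 1 / (k + 1 + y)\<close> the density dx/(1+x) turns into
  \<open>cf_weight k y\<close> times dy/(1+y). This identity is where the weights come from.\<close>

lemma nn_integral_gauss_cylinder:
  fixes F :: "real \<Rightarrow> real"
  assumes [measurable]: "F \<in> borel_measurable borel" and F0: "\<And>x. F x \<ge> 0"
  shows "(\<integral>\<^sup>+x. ennreal (F x) * indicator {1 / (real k + 2)<..1 / (real k + 1)} x \<partial>gauss_measure)
    = (\<integral>\<^sup>+y. ennreal (cf_weight k y * F (1 / (real k + 1 + y))) \<partial>gauss_measure)"
proof -
  define f where "f x = F x * (1 / (ln 2 * (1 + x)))" for x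
  \<comment> \<open>The branch itself is decreasing. Here \<open>g\<close> is its reflection,
    increasing as the substitution rule wants it, and the affine map \<open>1 - y\<close> undoes the
    reflection afterwards.\<close>
  define g where "g y = 1 / (real k + 2 - y)" for y
  define g' where "g' y = 1 / (real k + 2 - y)\<^sup>2" for y
  have f[measurable]: "f \<in> borel_measurable borel" unfolding f_def by measurable
  have [measurable]: "g \<in> borel_measurable borel" "g' \<in> borel_measurable borel"
    unfolding g_def g'_def by measurable
  have g01: "g 0 = 1 / (real k + 2)" "g 1 = 1 / (real k + 1)" by (simp_all add: g_def)
  have sub: "0 < x \<and> x \<le> 1" if "1 / (real k + 2) \<le> x" "x \<le> 1 / (real k + 1)" for x
    using that less_le_trans[of 0 "1 / (real k + 2)" x] order_trans[of x "1 / (real k + 1)" 1] by auto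
  have "(\<integral>\<^sup>+x. ennreal (F x) * indicator {1 / (real k + 2)<..1 / (real k + 1)} x \<partial>gauss_measure)
     = (\<integral>\<^sup>+x. ennreal (F x) * indicator {1 / (real k + 2)<..1 / (real k + 1)} x * ennreal (1 / (ln 2 * (1 + x))) * indicator {0<..1} x \<partial>lborel)"
    by (rule nn_integral_gauss_measure) measurable
  also have "\<dots> = (\<integral>\<^sup>+x. ennreal (f x * indicator {g 0..g 1} x) \<partial>lborel)"
  proof (intro nn_integral_cong_AE, use AE_lborel_singleton[of "1 / (real k + 2)"] in eventually_elim)
    fix x :: real assume x: "x \<noteq> 1 / (real k + 2)"
    show "ennreal (F x) * indicator {1 / (real k + 2)<..1 / (real k + 1)} x * ennreal (1 / (ln 2 * (1 + x))) * indicator {0<..1} x = ennreal (f x * indicator {g 0..g 1} x)"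
    proof (cases "x \<in> {g 0..g 1}")
      case True
      then show ?thesis using x sub[of x] F0[of x] by (auto simp: g01 f_def ennreal_mult'[symmetric])
    next
      case False
      then show ?thesis using x by (auto simp: g01 indicator_def)
    qed
  qed
  also have "\<dots> = (\<integral>\<^sup>+y. ennreal (f (g y) * g' y * indicator {0..1} y) \<partial>lborel)"
  proof (rule nn_integral_substitution)
    show "set_borel_measurable borel {g 0..g 1} f" unfolding set_borel_measurable_def by measurable
    show "(g has_real_derivative g' x) (at x)" if "x \<in> {0..1}" for x
      unfolding g_def g'_def using that
      by (auto intro!: derivative_eq_intros simp: power2_eq_square divide_simps)
    show "continuous_on {0..1} g'"
      unfolding g'_def by (intro continuous_intros) auto
  qed (auto simp: g'_def)
  also have "\<dots> = ennreal \<bar>-1\<bar> * (\<integral>\<^sup>+y. ennreal (f (g (1 + (-1) * y)) * g' (1 + (-1) * y) * indicator {0..1} (1 + (-1) * y)) \<partial>lborel)"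
    by (rule nn_integral_real_affine) auto
  also have "\<dots> = (\<integral>\<^sup>+y. ennreal (cf_weight k y * F (1 / (real k + 1 + y))) * ennreal (1 / (ln 2 * (1 + y))) * indicator {0<..1} y \<partial>lborel)"
  proof (simp, intro nn_integral_cong_AE, use AE_lborel_singleton[of "0 :: real"] in eventually_elim)
    fix y :: real assume y: "y \<noteq> 0"
    show "ennreal (f (g (1 - y)) * g' (1 - y) * indicator {0..1} (1 - y)) = ennreal (cf_weight k y * F (1 / (real k + 1 + y))) * ennreal (1 / (ln 2 * (1 + y))) * indicator {0<..1} y"
    proof (cases "y \<in> {0<..1}")
      case True
      define a where "a = real k + 1 + y"
      have a: "a > 1" using True by (auto simp: a_def)
      have "f (g (1 - y)) * g' (1 - y) = F (1 / a) * ((1 / (ln 2 * (1 + 1 / a))) * (1 / a\<^sup>2))"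
        by (simp add: f_def g_def g'_def a_def add_ac)
      also have "(1 / (ln 2 * (1 + 1 / a))) * (1 / a\<^sup>2) = 1 / (ln 2 * (a * (a + 1)))"
        using a by (simp add: divide_simps power2_eq_square)
      also have "\<dots> = cf_weight k y * (1 / (ln 2 * (1 + y)))"
      proof -
        have w: "cf_weight k y = (1 + y) / (a * (a + 1))" by (simp add: cf_weight_def a_def add_ac)
        have "1 + y \<noteq> 0" using True by auto
        then show ?thesis unfolding w by simp
      qed
      finally have "f (g (1 - y)) * g' (1 - y) = (cf_weight k y * F (1 / (real k + 1 + y))) * (1 / (ln 2 * (1 + y)))"
        by (simp add: a_def)
      moreover have "cf_weight k y * F (1 / (real k + 1 + y)) \<ge> 0" using True F0 by (simp add: cf_weight_nonneg)
      ultimately show ?thesis using True by (simp add: ennreal_mult'[symmetric])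
    next
      case False
      then show ?thesis using y by (auto simp: indicator_def)
    qed
  qed
  also have "\<dots> = (\<integral>\<^sup>+y. ennreal (cf_weight k y * F (1 / (real k + 1 + y))) \<partial>gauss_measure)"
    by (rule nn_integral_gauss_measure[symmetric]) measurable
  finally show ?thesis .
qed

text \<open>For indicators the nonnegative version says that two image measures coincide;
  integrating \<open>F\<close> against both gives the vector-valued statement at once.\<close>

lemma integral_gauss_cylinder:
  fixes F :: "real \<Rightarrow> 'a::{banach,second_countable_topology}"
  assumes F[measurable]: "F \<in> borel_measurable borel"
  shows "(\<integral>x. indicator {1 / (real k + 2)<..1 / (real k + 1)} x *\<^sub>R F x \<partial>gauss_measure)
    = (\<integral>y. cf_weight k y *\<^sub>R F (1 / (real k + 1 + y)) \<partial>gauss_measure)"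
proof -
  let ?J = "{1 / (real k + 2)<..1 / (real k + 1)} :: real set"
  let ?M1 = "density gauss_measure (\<lambda>x. ennreal (indicator ?J x))"
  let ?M2 = "density gauss_measure (\<lambda>y. ennreal (cf_weight k y))"
  let ?g = "\<lambda>y. 1 / (real k + 1 + y)"
  have "distr ?M1 borel (\<lambda>x. x) = distr ?M2 borel ?g"
  proof (rule measure_eqI)
    fix A :: "real set" assume "A \<in> sets (distr ?M1 borel (\<lambda>x. x))"
    then have A[measurable]: "A \<in> sets borel" by simp
    have "emeasure (distr ?M1 borel (\<lambda>x. x)) A = (\<integral>\<^sup>+x. indicator A x \<partial>distr ?M1 borel (\<lambda>x. x))"
      by simp
    also have "\<dots> = (\<integral>\<^sup>+x. ennreal (indicator ?J x) * indicator A x \<partial>gauss_measure)"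
      by (subst nn_integral_distr, simp, simp, subst nn_integral_density) simp_all
    also have "\<dots> = (\<integral>\<^sup>+x. ennreal (indicator A x) * indicator ?J x \<partial>gauss_measure)"
      by (intro nn_integral_cong) (auto simp: indicator_def)
    also have "\<dots> = (\<integral>\<^sup>+y. ennreal (cf_weight k y * indicator A (?g y)) \<partial>gauss_measure)"
      by (rule nn_integral_gauss_cylinder) auto
    also have "\<dots> = (\<integral>\<^sup>+y. ennreal (cf_weight k y) * indicator A (?g y) \<partial>gauss_measure)"
      by (intro nn_integral_cong) (auto simp: indicator_def)
    also have "\<dots> = (\<integral>\<^sup>+x. indicator A x \<partial>distr ?M2 borel ?g)"
      by (subst nn_integral_distr, simp, simp, subst nn_integral_density) simp_all
    also have "\<dots> = emeasure (distr ?M2 borel ?g) A" by simp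
    finally show "emeasure (distr ?M1 borel (\<lambda>x. x)) A = emeasure (distr ?M2 borel ?g) A" .
  qed simp
  then have "integral\<^sup>L (distr ?M1 borel (\<lambda>x. x)) F = integral\<^sup>L (distr ?M2 borel ?g) F" by simp
  moreover have "integral\<^sup>L (distr ?M1 borel (\<lambda>x. x)) F = (\<integral>x. indicator ?J x *\<^sub>R F x \<partial>gauss_measure)"
    by (subst integral_distr, simp, simp, subst integral_density) simp_all
  moreover have "integral\<^sup>L (distr ?M2 borel ?g) F = (\<integral>y. cf_weight k y *\<^sub>R F (?g y) \<partial>gauss_measure)"
    by (subst integral_distr, simp, simp, subst integral_density)
       (auto intro!: AE_I2 simp: space_gauss_measure cf_weight_nonneg)
  ultimately show ?thesis by simp
qed

text \<open>The cylinders partition the half-open unit interval, so a series of restrictions to them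
  has one nonzero term at each point. The natural subtraction does not truncate because
  \<open>1 / x\<close> is at least 1.\<close>

lemma gauss_cylinder_iff:
  assumes "x \<in> {0<..1}"
  shows "x \<in> {1 / (real k + 2)<..1 / (real k + 1)} \<longleftrightarrow> k = nat \<lfloor>1 / x\<rfloor> - 1"
proof -
  have "1 \<le> 1 / x" using assms by simp
  then have "1 \<le> \<lfloor>1 / x\<rfloor>" by linarith
  then have "k = nat \<lfloor>1 / x\<rfloor> - 1 \<longleftrightarrow> \<lfloor>1 / x\<rfloor> = int k + 1" by linarith
  also have "\<dots> \<longleftrightarrow> real k + 1 \<le> 1 / x \<and> 1 / x < real k + 2" by (simp add: floor_eq_iff add.commute)
  also have "\<dots> \<longleftrightarrow> x \<in> {1 / (real k + 2)<..1 / (real k + 1)}"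
    using assms by (auto simp: field_simps)
  finally show ?thesis by simp
qed

lemma gauss_integrable_bounded:
  fixes F :: "real \<Rightarrow> 'a::{banach,second_countable_topology}"
  assumes [measurable]: "F \<in> borel_measurable borel" and "\<And>x. x \<in> {0<..1} \<Longrightarrow> norm (F x) \<le> M"
  shows "integrable gauss_measure F"
  by (rule gauss.integrable_const_bound[where B = M]) (use assms in \<open>auto intro!: AE_I2 simp: space_gauss_measure\<close>)

text \<open>Splitting over the cylinders reduces this to two exchanges of series and integral, both
  dominated by \<open>2 * cf_weight k 0 * M\<close>, which does not depend on the point.\<close>

lemma integral_gauss_transfer:
  fixes F :: "real \<Rightarrow> 'a::{banach,second_countable_topology}"
  assumes F[measurable]: "F \<in> borel_measurable borel" and M: "\<And>x. x \<in> {0<..1} \<Longrightarrow> norm (F x) \<le> M"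
  shows "(\<integral>x. F x \<partial>gauss_measure) = (\<integral>y. (\<Sum>k. cf_weight k y *\<^sub>R F (1 / (real k + 1 + y))) \<partial>gauss_measure)"
proof -
  let ?J = "\<lambda>k. {1 / (real k + 2)<..1 / (real k + 1)} :: real set"
  let ?m = "\<lambda>k. cf_weight k 0"
  have M0: "M \<ge> 0" using norm_ge_zero M[of 1] by (rule order_trans) auto
  have smm: "summable (\<lambda>k. 2 * ?m k * M)"
    by (intro summable_mult summable_mult2 sums_summable[OF cf_weight_sums_1]) simp
  have gM: "norm (F (1 / (real k + 1 + y))) \<le> M" if "y \<in> {0<..1}" for y k
    by (rule M) (use that in auto)
  have pM: "norm (cf_weight k y *\<^sub>R F (1 / (real k + 1 + y))) \<le> 2 * ?m k * M" if "y \<in> {0<..1}" for y k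
    unfolding norm_scaleR using that gM[OF that] cf_weight_le[of y k] M0 by (intro mult_mono) (auto simp: cf_weight_nonneg)
  have i1: "integrable gauss_measure (\<lambda>x. indicator (?J k) x *\<^sub>R F x)" for k
    by (rule gauss_integrable_bounded[where M = M]) (use M M0 in \<open>auto simp: indicator_def\<close>)
  have i2: "integrable gauss_measure (\<lambda>y. cf_weight k y *\<^sub>R F (1 / (real k + 1 + y)))" for k
    by (rule gauss_integrable_bounded[OF _ pM]) auto
  have n2: "(\<integral>y. norm (cf_weight k y *\<^sub>R F (1 / (real k + 1 + y))) \<partial>gauss_measure) \<le> 2 * ?m k * M" for k
  proof -
    have "(\<integral>y. norm (cf_weight k y *\<^sub>R F (1 / (real k + 1 + y))) \<partial>gauss_measure) \<le> (\<integral>y. 2 * ?m k * M \<partial>gauss_measure)"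
      using i2 pM by (intro integral_mono integrable_norm) (auto simp: space_gauss_measure)
    then show ?thesis by (simp add: gauss.prob_space)
  qed
  have n1: "(\<integral>x. norm (indicator (?J k) x *\<^sub>R F x) \<partial>gauss_measure) \<le> 2 * ?m k * M" for k
  proof -
    have "(\<integral>x. norm (indicator (?J k) x *\<^sub>R F x) \<partial>gauss_measure) = (\<integral>x. indicator (?J k) x *\<^sub>R norm (F x) \<partial>gauss_measure)"
      by (intro Bochner_Integration.integral_cong) (auto simp: indicator_def)
    also have "\<dots> = (\<integral>y. cf_weight k y *\<^sub>R norm (F (1 / (real k + 1 + y))) \<partial>gauss_measure)"
      by (rule integral_gauss_cylinder) measurable
    also have "\<dots> = (\<integral>y. norm (cf_weight k y *\<^sub>R F (1 / (real k + 1 + y))) \<partial>gauss_measure)"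
      by (intro Bochner_Integration.integral_cong) (auto simp: space_gauss_measure cf_weight_nonneg)
    finally show ?thesis using n2 by simp
  qed
  have e: "(\<lambda>k. indicator (?J k) x *\<^sub>R F x) = (\<lambda>k. if k = nat \<lfloor>1 / x\<rfloor> - 1 then F x else 0)" if "x \<in> {0<..1}" for x
    unfolding fun_eq_iff indicator_def gauss_cylinder_iff[OF that] by simp
  have en: "(\<lambda>k. norm (indicator (?J k) x *\<^sub>R F x)) = (\<lambda>k. if k = nat \<lfloor>1 / x\<rfloor> - 1 then norm (F x) else 0)" if "x \<in> {0<..1}" for x
    using e[OF that] unfolding fun_eq_iff by simp
  have "(\<integral>x. F x \<partial>gauss_measure) = (\<integral>x. (\<Sum>k. indicator (?J k) x *\<^sub>R F x) \<partial>gauss_measure)"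
    by (intro Bochner_Integration.integral_cong) (simp_all only: space_gauss_measure e sums_unique[OF sums_single, symmetric])
  also have "\<dots> = (\<Sum>k. \<integral>x. indicator (?J k) x *\<^sub>R F x \<partial>gauss_measure)"
  proof (rule integral_suminf[OF i1])
    show "AE x in gauss_measure. summable (\<lambda>k. norm (indicator (?J k) x *\<^sub>R F x))"
      by (intro AE_I2) (simp only: space_gauss_measure en sums_summable[OF sums_single])
    show "summable (\<lambda>k. \<integral>x. norm (indicator (?J k) x *\<^sub>R F x) \<partial>gauss_measure)"
      by (rule summable_comparison_test'[OF smm, of 0]) (use n1 in auto)
  qed
  also have "\<dots> = (\<Sum>k. \<integral>y. cf_weight k y *\<^sub>R F (1 / (real k + 1 + y)) \<partial>gauss_measure)"
    by (simp only: integral_gauss_cylinder[OF F])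
  also have "\<dots> = (\<integral>y. (\<Sum>k. cf_weight k y *\<^sub>R F (1 / (real k + 1 + y))) \<partial>gauss_measure)"
  proof (rule integral_suminf[OF i2, symmetric])
    show "AE y in gauss_measure. summable (\<lambda>k. norm (cf_weight k y *\<^sub>R F (1 / (real k + 1 + y))))"
      by (intro AE_I2 summable_comparison_test'[OF smm, of 0]) (use pM in \<open>auto simp: space_gauss_measure\<close>)
    show "summable (\<lambda>k. \<integral>y. norm (cf_weight k y *\<^sub>R F (1 / (real k + 1 + y))) \<partial>gauss_measure)"
      by (rule summable_comparison_test'[OF smm, of 0]) (use n2 in auto)
  qed
  finally show ?thesis .
qed

section \<open>Duality between the Gauss map and its transfer operator\<close>

lemma gauss_map_measurable [measurable]: "gauss_map \<in> borel_measurable borel"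
  unfolding gauss_map_def[abs_def] frac_def by measurable

lemma cf_digit_measurable [measurable]: "cf_digit n \<in> borel \<rightarrow>\<^sub>M count_space UNIV"
proof -
  have [measurable]: "(gauss_map ^^ m) \<in> borel_measurable borel" for m
    by (induction m) auto
  show ?thesis unfolding cf_digit_def[abs_def] by measurable
qed

lemma gauss_map_unit: "gauss_map x \<in> {0..1}"
  using frac_ge_0 frac_lt_1[THEN less_imp_le] by (auto simp: gauss_map_def)

lemma cf_digit_inverse:
  assumes "y \<in> {0<..<1}"
  shows "cf_digit (Suc 0) (1 / (real k + 1 + y)) = Suc k" "gauss_map (1 / (real k + 1 + y)) = y"
proof -
  have "\<lfloor>real k + 1 + y\<rfloor> = int k + 1" using assms by (simp add: floor_eq_iff)
  then show "cf_digit (Suc 0) (1 / (real k + 1 + y)) = Suc k" "gauss_map (1 / (real k + 1 + y)) = y"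
    by (simp_all add: cf_digit_def gauss_map_def frac_def)
qed

lemma digit_op_measurable:
  fixes w :: "real \<Rightarrow> 'a::{real_normed_field,banach,second_countable_topology}"
  assumes [measurable]: "w \<in> borel_measurable borel"
  shows "gauss_op h w \<in> borel_measurable borel"
  unfolding digit_op_def[abs_def] by measurable

text \<open>On the k-th branch the first digit is \<open>Suc k\<close> and the Gauss map returns
  \<open>y\<close>, so \<open>G y\<close> can be taken out of the series. Invariance, covariances
  and products over digits are all instances of this duality.\<close>

lemma integral_gauss_shift:
  fixes w :: "real \<Rightarrow> 'a::{real_normed_field,banach,second_countable_topology}"
  assumes h: "\<And>k. norm (h k) \<le> H"
    and G[measurable]: "G \<in> borel_measurable borel" "\<And>t. t \<in> {0..1} \<Longrightarrow> norm (G t) \<le> B"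
    and w[measurable]: "w \<in> borel_measurable borel" "\<And>t. t \<in> {0..1} \<Longrightarrow> norm (w t) \<le> M"
  shows "(\<integral>x. h (cf_digit 1 x) * G (gauss_map x) * w x \<partial>gauss_measure) = (\<integral>x. G x * gauss_op h w x \<partial>gauss_measure)"
proof -
  let ?F = "\<lambda>x. h (cf_digit 1 x) * G (gauss_map x) * w x"
  have [measurable]: "(\<lambda>x. h (cf_digit 1 x)) \<in> borel_measurable borel"
    by (rule measurable_compose[OF cf_digit_measurable]) simp
  have F[measurable]: "?F \<in> borel_measurable borel" by measurable
  have H0: "H \<ge> 0" using norm_ge_zero h by (rule order_trans)
  have B0: "B \<ge> 0" using norm_ge_zero G(2)[of 0] by (rule order_trans) simp
  have "norm (?F x) \<le> H * B * M" if "x \<in> {0<..1}" for x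
    unfolding norm_mult using that h G(2)[OF gauss_map_unit] w(2)[of x] H0 B0 by (intro mult_mono) auto
  then have "(\<integral>x. ?F x \<partial>gauss_measure) = (\<integral>y. (\<Sum>k. cf_weight k y *\<^sub>R ?F (1 / (real k + 1 + y))) \<partial>gauss_measure)"
    by (rule integral_gauss_transfer[OF F])
  also have "\<dots> = (\<integral>x. G x * gauss_op h w x \<partial>gauss_measure)"
  proof (rule integral_cong_AE)
    show "AE y in gauss_measure. (\<Sum>k. cf_weight k y *\<^sub>R ?F (1 / (real k + 1 + y))) = G y * gauss_op h w y"
      using AE_gauss_measure_unit
    proof eventually_elim
      fix y :: real assume y: "y \<in> {0<..<1}"
      have hw: "norm (h (Suc k) * w (1 / (real k + 1 + y))) \<le> H * M" for k
        unfolding norm_mult using y H0 by (intro mult_mono h w) auto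
      have sm: "summable (\<lambda>k. cf_weight k y * (H * M))"
        using y by (intro summable_mult2 sums_summable[OF cf_weight_sums_1]) auto
      have "summable (\<lambda>k. cf_weight k y *\<^sub>R (h (Suc k) * w (1 / (real k + 1 + y))))"
      proof (rule summable_comparison_test'[OF sm, of 0])
        fix k show "norm (cf_weight k y *\<^sub>R (h (Suc k) * w (1 / (real k + 1 + y)))) \<le> cf_weight k y * (H * M)"
          unfolding norm_scaleR using hw[of k] cf_weight_nonneg[of y k] y by (intro mult_mono) auto
      qed
      from suminf_mult[OF this, of "G y"]
      show "(\<Sum>k. cf_weight k y *\<^sub>R ?F (1 / (real k + 1 + y))) = G y * gauss_op h w y"
        unfolding digit_op_def One_nat_def cf_digit_inverse[OF y] by (simp add: mult_ac)
    qed
  qed (use digit_op_measurable[OF w(1)] in measurable)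
  finally show ?thesis .
qed

lemma integral_gauss_invariant:
  fixes G :: "real \<Rightarrow> 'a::{real_normed_field,banach,second_countable_topology}"
  assumes "G \<in> borel_measurable borel" "\<And>t. t \<in> {0..1} \<Longrightarrow> norm (G t) \<le> B"
  shows "(\<integral>x. G (gauss_map x) \<partial>gauss_measure) = (\<integral>x. G x \<partial>gauss_measure)"
proof -
  have "(\<integral>x. 1 * G (gauss_map x) * 1 \<partial>gauss_measure) = (\<integral>x. G x * gauss_op (\<lambda>_. 1) (\<lambda>_. 1) x \<partial>gauss_measure)"
    by (rule integral_gauss_shift[where H = 1 and M = 1]) (use assms in auto)
  also have "\<dots> = (\<integral>x. G x \<partial>gauss_measure)"
  proof (intro Bochner_Integration.integral_cong refl)
    fix x assume "x \<in> space gauss_measure"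
    then have "(\<lambda>k. cf_weight k x *\<^sub>R (1 :: 'a)) sums (1 *\<^sub>R 1)"
      by (intro sums_scaleR_left cf_weight_sums_1) (auto simp: space_gauss_measure)
    then show "G x * gauss_op (\<lambda>_. 1) (\<lambda>_. 1) x = G x"
      by (simp add: digit_op_def sums_iff)
  qed
  finally show ?thesis by simp
qed

subsection \<open>Variance of digit sums and sufficiency\<close>

lemma digit_comp_measurable [measurable]: "(\<lambda>x. h (cf_digit k x)) \<in> borel_measurable borel"
  by (rule measurable_compose[OF cf_digit_measurable]) simp

lemma integral_first_digit:
  fixes h :: "nat \<Rightarrow> 'a::{real_normed_field,banach,second_countable_topology}"
  assumes "\<And>k. norm (h k) \<le> H"
  shows "(\<integral>x. h (cf_digit 1 x) \<partial>gauss_measure) = (\<integral>x. gauss_op h (\<lambda>_. 1) x \<partial>gauss_measure)"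
  using integral_gauss_shift[of h H "\<lambda>_. 1" 1 "\<lambda>_. 1" 1, OF assms] by simp

lemma gauss_measure_bounded_mono:
  fixes u v :: "real \<Rightarrow> real"
  assumes [measurable]: "u \<in> borel_measurable borel" "v \<in> borel_measurable borel"
    and "\<And>x. x \<in> {0..1} \<Longrightarrow> \<bar>u x\<bar> \<le> M" "\<And>x. x \<in> {0..1} \<Longrightarrow> \<bar>v x\<bar> \<le> M" 
    and "\<And>x. x \<in> {0..1} \<Longrightarrow> u x \<le> v x"
  shows "(\<integral>x. u x \<partial>gauss_measure) \<le> (\<integral>x. v x \<partial>gauss_measure)"
  by (rule integral_mono) (use assms in \<open>auto intro!: gauss_integrable_bounded[where M = M] simp: space_gauss_measure\<close>)

text \<open>The numbers \<open>cf_weight k 0 = 1 / ((k + 1) * (k + 2))\<close> are the law of the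
  first digit under Lebesgue measure. It and the law under the Gauss measure are comparable within a
  factor 2, so estimates may use the explicit weights.\<close>

lemma first_digit_law_bounds:
  fixes h :: "nat \<Rightarrow> real"
  assumes h: "\<And>k. 0 \<le> h k" "\<And>k. h k \<le> H" and m: "(\<lambda>k. cf_weight k 0 * h (Suc k)) sums m"
  shows "m / 2 \<le> (\<integral>x. h (cf_digit 1 x) \<partial>gauss_measure)" "(\<integral>x. h (cf_digit 1 x) \<partial>gauss_measure) \<le> 2 * m"
proof -
  have m0: "0 \<le> m" by (rule sums_le[OF _ sums_zero m]) (use h in \<open>auto simp: cf_weight_nonneg\<close>)
  have hH: "norm (h k) \<le> H" for k using h[of k] by simp
  have s: "summable (\<lambda>k. cf_weight k x * h (Suc k))" if "x \<in> {0..1}" for x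
    using digit_op_summable[of cf_weight x h H "\<lambda>_. 1" 1, OF cf_weight_sums_1 cf_weight_nonneg hH] that by simp
  have b: "m / 2 \<le> gauss_op h (\<lambda>_. 1) x \<and> gauss_op h (\<lambda>_. 1) x \<le> 2 * m" if "x \<in> {0..1}" for x
  proof -
    have "(\<lambda>k. cf_weight k 0 / 2 * h (Suc k)) sums (m / 2)"
      using sums_divide[OF m, of 2] by simp
    then have "m / 2 \<le> (\<Sum>k. cf_weight k x * h (Suc k))"
      by (rule sums_le[OF _ _ summable_sums[OF s[OF that]], rotated])
         (intro mult_right_mono cf_weight_ge[OF that] h)
    moreover have "(\<lambda>k. 2 * cf_weight k 0 * h (Suc k)) sums (2 * m)"
      using sums_mult[OF m, of 2] by (simp add: mult.assoc)
    then have "(\<Sum>k. cf_weight k x * h (Suc k)) \<le> 2 * m"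
      by (rule sums_le[OF _ summable_sums[OF s[OF that]], rotated])
         (intro mult_right_mono cf_weight_le[OF that] h)
    ultimately show ?thesis by (simp add: digit_op_def)
  qed
  have b': "\<bar>gauss_op h (\<lambda>_. 1) x\<bar> \<le> 2 * m" if "x \<in> {0..1}" for x using b[OF that] m0 by linarith
  have [measurable]: "gauss_op h (\<lambda>_. 1) \<in> borel_measurable borel" by (rule digit_op_measurable) simp
  note e = integral_first_digit[of h H, OF hH]
  have "(\<integral>x. m / 2 \<partial>gauss_measure) \<le> (\<integral>x. gauss_op h (\<lambda>_. 1) x \<partial>gauss_measure)"
    by (rule gauss_measure_bounded_mono[where M = "2 * m"]) (use b b' m0 in auto)
  then show "m / 2 \<le> (\<integral>x. h (cf_digit 1 x) \<partial>gauss_measure)" unfolding e by (simp add: gauss.prob_space)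
  have "(\<integral>x. gauss_op h (\<lambda>_. 1) x \<partial>gauss_measure) \<le> (\<integral>x. 2 * m \<partial>gauss_measure)"
    by (rule gauss_measure_bounded_mono[where M = "2 * m"]) (use b b' m0 in auto)
  then show "(\<integral>x. h (cf_digit 1 x) \<partial>gauss_measure) \<le> 2 * m" unfolding e by (simp add: gauss.prob_space)
qed

text \<open>Only the weights vary here: 4 comes from \<open>cf_weight_diff_le\<close> and 2 from
  changing mu into the Gauss law. A bound by the expectation of the modulus, instead of by
  \<open>H\<close>, is essential: its square is later bounded by the second moment.\<close>

lemma digit_op_1_lipschitz:
  fixes g :: "nat \<Rightarrow> real"
  assumes g: "\<And>k. \<bar>g k\<bar> \<le> H"
  shows "(8 * (\<integral>x. \<bar>g (cf_digit 1 x)\<bar> \<partial>gauss_measure))-lipschitz_on {0..1} (gauss_op g (\<lambda>_. 1))"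
proof (rule lipschitz_onI)
  let ?m = "\<lambda>k. cf_weight k 0" and ?E = "\<integral>x. \<bar>g (cf_digit 1 x)\<bar> \<partial>gauss_measure"
  show "0 \<le> 8 * ?E" by simp
  have s: "summable (\<lambda>k. cf_weight k x *\<^sub>R v k)" if "x \<in> {0..1}" "\<And>k. norm (v k) \<le> H" for x and v :: "nat \<Rightarrow> real"
    by (rule norm_weighted_suminf_le(1)[OF sums_summable[OF cf_weight_sums_1] cf_weight_nonneg]) (use that in auto)
  obtain m where m: "(\<lambda>k. ?m k * \<bar>g (Suc k)\<bar>) sums m"
    using s[of 0 "\<lambda>k. \<bar>g (Suc k)\<bar>"] g by (auto simp: summable_def)
  have mE: "m \<le> 2 * ?E" using first_digit_law_bounds(1)[of "\<lambda>k. \<bar>g k\<bar>" H, OF _ g m] by simp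
  fix x y :: real assume xy: "x \<in> {0..1}" "y \<in> {0..1}"
  have sx: "summable (\<lambda>k. cf_weight k x * g (Suc k))" "summable (\<lambda>k. cf_weight k y * g (Suc k))"
    using s[of x "\<lambda>k. g (Suc k)"] s[of y "\<lambda>k. g (Suc k)"] xy g by auto
  have le: "norm ((cf_weight k x - cf_weight k y) * g (Suc k)) \<le> 4 * \<bar>x - y\<bar> * (?m k * \<bar>g (Suc k)\<bar>)" for k
    unfolding real_norm_def abs_mult mult.assoc[symmetric] using xy cf_weight_diff_le[of x y k]
    by (intro mult_right_mono) (auto simp: mult.assoc)
  have sm: "(\<lambda>k. 4 * \<bar>x - y\<bar> * (?m k * \<bar>g (Suc k)\<bar>)) sums (4 * \<bar>x - y\<bar> * m)" by (intro sums_mult m)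
  have sn: "summable (\<lambda>k. norm ((cf_weight k x - cf_weight k y) * g (Suc k)))"
    by (rule summable_comparison_test'[OF sums_summable[OF sm], of 0]) (use le in auto)
  have "gauss_op g (\<lambda>_. 1) x - gauss_op g (\<lambda>_. 1) y = (\<Sum>k. (cf_weight k x - cf_weight k y) * g (Suc k))"
    using suminf_diff[OF sx] by (simp add: digit_op_def left_diff_distrib)
  also have "norm \<dots> \<le> 4 * \<bar>x - y\<bar> * m"
    using order_trans[OF summable_norm[OF sn] suminf_le[OF le sn sums_summable[OF sm]]] sums_unique[OF sm] by simp
  also have "\<dots> \<le> 4 * \<bar>x - y\<bar> * (2 * ?E)" by (intro mult_left_mono mE) auto
  finally show "dist (gauss_op g (\<lambda>_. 1) x) (gauss_op g (\<lambda>_. 1) y) \<le> 8 * ?E * dist x y"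
    by (simp add: dist_real_def mult_ac)
qed

text \<open>This lets the Lipschitz constant alone drive the covariance induction, as it also bounds
  the sup norm.\<close>

lemma mean_zero_lipschitz_le:
  fixes u :: "real \<Rightarrow> real"
  assumes [measurable]: "u \<in> borel_measurable borel" and lip: "l-lipschitz_on {0..1} u"
    and mean: "(\<integral>x. u x \<partial>gauss_measure) = 0" and x: "x \<in> {0..1}"
  shows "\<bar>u x\<bar> \<le> l"
proof -
  have l: "l \<ge> 0" using lip by (rule lipschitz_on_nonneg)
  have d: "\<bar>u x - u y\<bar> \<le> l" if "y \<in> {0..1}" for y
  proof -
    have "\<bar>u x - u y\<bar> \<le> l * \<bar>x - y\<bar>" using lipschitz_onD[OF lip x that] by (simp add: dist_real_def)
    also have "\<dots> \<le> l * 1" using x that l by (intro mult_left_mono) auto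
    finally show ?thesis by simp
  qed
  have d1: "u x - l \<le> u y" and d2: "u y \<le> u x + l" if "y \<in> {0..1}" for y using d[OF that] by linarith+
  have b: "\<bar>u y\<bar> \<le> \<bar>u x\<bar> + l" if "y \<in> {0..1}" for y using d[OF that] by linarith
  have "(\<integral>y. u x - l \<partial>gauss_measure) \<le> (\<integral>y. u y \<partial>gauss_measure)"
    by (rule gauss_measure_bounded_mono[where M = "\<bar>u x\<bar> + l"]) (use d1 d2 b l in auto)
  moreover have "(\<integral>y. u y \<partial>gauss_measure) \<le> (\<integral>y. u x + l \<partial>gauss_measure)"
    by (rule gauss_measure_bounded_mono[where M = "\<bar>u x\<bar> + l"]) (use d1 d2 b l in auto)
  ultimately show ?thesis unfolding mean by (simp add: gauss.prob_space)
qed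

section \<open>Covariances and variance of digit sums\<close>

definition digit_sum :: "(nat \<Rightarrow> real) \<Rightarrow> nat \<Rightarrow> real \<Rightarrow> real" where
  "digit_sum g n x = (\<Sum>k=1..n. g (cf_digit k x))"

lemma digit_sum_measurable [measurable]: "digit_sum g n \<in> borel_measurable borel"
  unfolding digit_sum_def[abs_def] by measurable

lemma digit_sum_Suc: "digit_sum g (Suc n) x = g (cf_digit 1 x) + digit_sum g n (gauss_map x)"
proof -
  have "digit_sum g (Suc n) x = g (cf_digit 1 x) + (\<Sum>k=Suc 1..Suc n. g (cf_digit k x))"
    unfolding digit_sum_def by (subst sum.atLeast_Suc_atMost) auto
  also have "(\<Sum>k=Suc 1..Suc n. g (cf_digit k x)) = (\<Sum>k=1..n. g (cf_digit (Suc k) x))"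
    by (rule sum.shift_bounds_cl_Suc_ivl)
  also have "\<dots> = digit_sum g n (gauss_map x)"
    unfolding digit_sum_def by (intro sum.cong) (auto simp: cf_digit_Suc)
  finally show ?thesis .
qed

lemma digit_sum_bounded:
  assumes "\<And>k. \<bar>g k\<bar> \<le> H"
  shows "\<bar>digit_sum g n x\<bar> \<le> real n * H"
proof -
  have "\<bar>digit_sum g n x\<bar> \<le> (\<Sum>k=1..n. \<bar>g (cf_digit k x)\<bar>)" unfolding digit_sum_def by (rule sum_abs)
  also have "\<dots> \<le> real n * H" using sum_bounded_above[of "{1..n}" "\<lambda>k. \<bar>g (cf_digit k x)\<bar>" H] assms by simp
  finally show ?thesis .
qed

text \<open>Peeling off the first digit costs \<open>l\<close> times the expectation of the modulus,
  and the remaining sum is paired with \<open>gauss_op (\<lambda>_. 1) u\<close>, whose Lipschitz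
  constant is 7/8 of \<open>l\<close>. The constant 8 is the geometric sum 1/(1 - 7/8), so the bound
  is uniform in \<open>n\<close>.\<close>

lemma covariance_digit_sum_le:
  fixes g :: "nat \<Rightarrow> real"
  assumes g: "\<And>k. \<bar>g k\<bar> \<le> H"
    and u: "u \<in> borel_measurable borel" "l-lipschitz_on {0..1} u" "(\<integral>x. u x \<partial>gauss_measure) = 0"
  shows "\<bar>\<integral>x. u x * digit_sum g n x \<partial>gauss_measure\<bar> \<le> 8 * l * (\<integral>x. \<bar>g (cf_digit 1 x)\<bar> \<partial>gauss_measure)"
  using u
proof (induction n arbitrary: u l)
  case 0
  then have "l \<ge> 0" using lipschitz_on_nonneg by blast
  then show ?case by (simp add: digit_sum_def)
next
  case (Suc n)
  note [measurable] = Suc.prems(1)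
  let ?E = "\<integral>x. \<bar>g (cf_digit 1 x)\<bar> \<partial>gauss_measure" and ?v = "gauss_op (\<lambda>_. 1) u"
  have l: "l \<ge> 0" using Suc.prems lipschitz_on_nonneg by blast
  have ul: "\<bar>u x\<bar> \<le> l" if "x \<in> {0..1}" for x by (rule mean_zero_lipschitz_le[OF Suc.prems that])
  have H0: "H \<ge> 0" using abs_ge_zero g by (rule order_trans)
  have v: "?v \<in> borel_measurable borel" by (rule digit_op_measurable) (rule Suc.prems)
  have vl: "(7 / 8 * l)-lipschitz_on {0..1} ?v"
    using gauss_op_lipschitz[of "\<lambda>_. 1 :: real" 1 l u l 0, OF _ _ Suc.prems(2)] ul by simp
  have v0: "(\<integral>x. ?v x \<partial>gauss_measure) = 0"
    using integral_gauss_shift[of "\<lambda>_. 1 :: real" 1 "\<lambda>_. 1" 1 u l] ul Suc.prems by simp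
  have n: "\<bar>digit_sum g n t\<bar> \<le> real n * H" for t by (rule digit_sum_bounded[OF g])
  have i1: "integrable gauss_measure (\<lambda>x. u x * g (cf_digit 1 x))"
    by (rule gauss_integrable_bounded[where M = "l * H"])
       (use ul g H0 l in \<open>auto simp: abs_mult intro!: mult_mono\<close>)
  have i2: "integrable gauss_measure (\<lambda>x. u x * digit_sum g n (gauss_map x))"
    by (rule gauss_integrable_bounded[where M = "l * (real n * H)"])
       (use ul n H0 l in \<open>auto simp: abs_mult intro!: mult_mono\<close>)
  have "(\<integral>x. u x * digit_sum g (Suc n) x \<partial>gauss_measure) =
      (\<integral>x. u x * g (cf_digit 1 x) \<partial>gauss_measure) + (\<integral>x. u x * digit_sum g n (gauss_map x) \<partial>gauss_measure)"
    unfolding digit_sum_Suc distrib_left by (rule Bochner_Integration.integral_add[OF i1 i2])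
  also have "(\<integral>x. u x * digit_sum g n (gauss_map x) \<partial>gauss_measure) = (\<integral>x. ?v x * digit_sum g n x \<partial>gauss_measure)"
    using integral_gauss_shift[of "\<lambda>_. 1 :: real" 1 "digit_sum g n" "real n * H" u l] ul n Suc.prems(1) 
    by (simp add: mult.commute)
  finally have "\<bar>\<integral>x. u x * digit_sum g (Suc n) x \<partial>gauss_measure\<bar> \<le>
     \<bar>\<integral>x. u x * g (cf_digit 1 x) \<partial>gauss_measure\<bar> + \<bar>\<integral>x. ?v x * digit_sum g n x \<partial>gauss_measure\<bar>" by simp
  also have "\<bar>\<integral>x. ?v x * digit_sum g n x \<partial>gauss_measure\<bar> \<le> 8 * (7 / 8 * l) * ?E"
    by (rule Suc.IH[OF v vl v0])
  also have "\<bar>\<integral>x. u x * g (cf_digit 1 x) \<partial>gauss_measure\<bar> \<le> (\<integral>x. \<bar>u x * g (cf_digit 1 x)\<bar> \<partial>gauss_measure)"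
    by (rule integral_abs_bound)
  also have "\<dots> \<le> (\<integral>x. l * \<bar>g (cf_digit 1 x)\<bar> \<partial>gauss_measure)"
    by (rule gauss_measure_bounded_mono[where M = "l * H"])
       (use ul g H0 l in \<open>auto simp: abs_mult intro!: mult_mono\<close>)
  also have "\<dots> = l * ?E" by simp
  finally show ?case by simp
qed

lemma integral_abs_power2_le:
  fixes g :: "nat \<Rightarrow> real"
  assumes g: "\<And>k. \<bar>g k\<bar> \<le> H"
  shows "(\<integral>x. \<bar>g (cf_digit 1 x)\<bar> \<partial>gauss_measure)\<^sup>2 \<le> (\<integral>x. (g (cf_digit 1 x))\<^sup>2 \<partial>gauss_measure)"
proof -
  have H0: "H \<ge> 0" using abs_ge_zero g by (rule order_trans)
  have i: "integrable gauss_measure (\<lambda>x. \<bar>g (cf_digit 1 x)\<bar>)"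
    by (rule gauss_integrable_bounded[where M = H]) (use g in auto)
  have g2: "(g k)\<^sup>2 \<le> H\<^sup>2" for k using g[of k] H0 by (intro abs_le_square_iff[THEN iffD1]) auto
  have i2: "integrable gauss_measure (\<lambda>x. \<bar>g (cf_digit 1 x)\<bar>\<^sup>2)"
    by (rule gauss_integrable_bounded[where M = "H\<^sup>2"]) (use g2 in auto)
  have "0 \<le> (\<integral>x. (\<bar>g (cf_digit 1 x)\<bar> - (\<integral>x. \<bar>g (cf_digit 1 x)\<bar> \<partial>gauss_measure))\<^sup>2 \<partial>gauss_measure)"
    by (rule Bochner_Integration.integral_nonneg) simp
  then show ?thesis unfolding gauss.variance_eq[OF i i2] by simp
qed

text \<open>Each new digit adds its second moment and twice a covariance. The covariance is at most
  8 * 8 times the squared expectation of the modulus: one 8 from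
  \<open>digit_op_1_lipschitz\<close>, the other from \<open>covariance_digit_sum_le\<close>. Thus
  129 = 1 + 2 * 64.\<close>

lemma second_moment_digit_sum_le:
  fixes g :: "nat \<Rightarrow> real"
  assumes g: "\<And>k. \<bar>g k\<bar> \<le> H" and mean: "(\<integral>x. g (cf_digit 1 x) \<partial>gauss_measure) = 0"
  shows "(\<integral>x. (digit_sum g n x)\<^sup>2 \<partial>gauss_measure) \<le> 129 * real n * (\<integral>x. (g (cf_digit 1 x))\<^sup>2 \<partial>gauss_measure)"
proof (induction n)
  case 0
  show ?case by (simp add: digit_sum_def)
next
  case (Suc n)
  let ?E = "\<integral>x. \<bar>g (cf_digit 1 x)\<bar> \<partial>gauss_measure" and ?Q = "\<integral>x. (g (cf_digit 1 x))\<^sup>2 \<partial>gauss_measure"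
  let ?S = "digit_sum g n" and ?u = "gauss_op g (\<lambda>_. 1)"
  have H0: "H \<ge> 0" using abs_ge_zero g by (rule order_trans)
  have n: "\<bar>?S t\<bar> \<le> real n * H" for t by (rule digit_sum_bounded[OF g])
  have n2: "\<bar>(?S t)\<^sup>2\<bar> \<le> (real n * H)\<^sup>2" for t using n[of t] H0 by (simp add: abs_le_square_iff[symmetric])
  have g2: "(g k)\<^sup>2 \<le> H\<^sup>2" for k using g[of k] H0 by (intro abs_le_square_iff[THEN iffD1]) auto
  have i1: "integrable gauss_measure (\<lambda>x. (g (cf_digit 1 x))\<^sup>2)"
    by (rule gauss_integrable_bounded[where M = "H\<^sup>2"]) (use g2 in auto)
  have i2: "integrable gauss_measure (\<lambda>x. g (cf_digit 1 x) * ?S (gauss_map x))"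
    by (rule gauss_integrable_bounded[where M = "H * (real n * H)"])
       (use n g H0 in \<open>auto simp: abs_mult intro!: mult_mono\<close>)
  have i3: "integrable gauss_measure (\<lambda>x. (?S (gauss_map x))\<^sup>2)"
    by (rule gauss_integrable_bounded[where M = "(real n * H)\<^sup>2"]) (use n2 in auto)
  have u: "?u \<in> borel_measurable borel" by (rule digit_op_measurable) simp
  have u0: "(\<integral>x. ?u x \<partial>gauss_measure) = 0"
    using integral_first_digit[of g H] g mean by simp
  have "(\<integral>x. (digit_sum g (Suc n) x)\<^sup>2 \<partial>gauss_measure) = (\<integral>x. (g (cf_digit 1 x))\<^sup>2 + 2 * (g (cf_digit 1 x) * ?S (gauss_map x)) + (?S (gauss_map x))\<^sup>2 \<partial>gauss_measure)"
    unfolding digit_sum_Suc power2_sum by (simp add: mult_ac add_ac)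
  also have "\<dots> = ?Q + 2 * (\<integral>x. g (cf_digit 1 x) * ?S (gauss_map x) \<partial>gauss_measure) + (\<integral>x. (?S (gauss_map x))\<^sup>2 \<partial>gauss_measure)"
    using i1 i2 i3 by simp
  also have "(\<integral>x. g (cf_digit 1 x) * ?S (gauss_map x) \<partial>gauss_measure) = (\<integral>x. ?u x * ?S x \<partial>gauss_measure)"
    using integral_gauss_shift[of g H ?S "real n * H" "\<lambda>_. 1" 1] g n by (simp add: mult.commute)
  also have "(\<integral>x. (?S (gauss_map x))\<^sup>2 \<partial>gauss_measure) = (\<integral>x. (?S x)\<^sup>2 \<partial>gauss_measure)"
    by (rule integral_gauss_invariant[where B = "(real n * H)\<^sup>2"]) (use n2 in auto)
  also have "(\<integral>x. ?u x * ?S x \<partial>gauss_measure) \<le> 8 * (8 * ?E) * ?E"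
    using covariance_digit_sum_le[where g = g and n = n, OF g u digit_op_1_lipschitz[OF g] u0] by linarith
  also have "8 * (8 * ?E) * ?E \<le> 64 * ?Q"
    using integral_abs_power2_le[of g H, OF g] by (simp add: power2_eq_square)
  finally show ?case using Suc.IH by (simp add: algebra_simps)
qed

lemma variance_digit_sum_le:
  fixes g :: "nat \<Rightarrow> real"
  assumes g: "\<And>k. \<bar>g k\<bar> \<le> H" 
  defines "a \<equiv> \<integral>x. g (cf_digit 1 x) \<partial>gauss_measure"
  shows "(\<integral>x. (digit_sum g n x - real n * a)\<^sup>2 \<partial>gauss_measure) \<le> 129 * real n * (\<integral>x. (g (cf_digit 1 x))\<^sup>2 \<partial>gauss_measure)"
proof -
  define h where "h k = g k - a" for k
  have H0: "H \<ge> 0" using abs_ge_zero g by (rule order_trans)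
  have i: "integrable gauss_measure (\<lambda>x. g (cf_digit 1 x))"
    by (rule gauss_integrable_bounded[where M = H]) (use g in auto)
  have g2: "(g k)\<^sup>2 \<le> H\<^sup>2" for k using g[of k] H0 by (intro abs_le_square_iff[THEN iffD1]) auto
  have i2: "integrable gauss_measure (\<lambda>x. (g (cf_digit 1 x))\<^sup>2)"
    by (rule gauss_integrable_bounded[where M = "H\<^sup>2"]) (use g2 in auto)
  have hb: "\<bar>h k\<bar> \<le> H + \<bar>a\<bar>" for k using g[of k] by (simp add: h_def)
  have h0: "(\<integral>x. h (cf_digit 1 x) \<partial>gauss_measure) = 0"
    using i by (simp add: h_def a_def gauss.prob_space)
  have e: "digit_sum h n x = digit_sum g n x - real n * a" for x
    by (simp add: digit_sum_def h_def sum_subtractf)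
  have "(\<integral>x. (h (cf_digit 1 x))\<^sup>2 \<partial>gauss_measure) = (\<integral>x. (g (cf_digit 1 x))\<^sup>2 \<partial>gauss_measure) - a\<^sup>2"
    using gauss.variance_eq[OF i i2] by (simp add: h_def a_def)
  then have "(\<integral>x. (h (cf_digit 1 x))\<^sup>2 \<partial>gauss_measure) \<le> (\<integral>x. (g (cf_digit 1 x))\<^sup>2 \<partial>gauss_measure)" by simp
  then have "129 * real n * (\<integral>x. (h (cf_digit 1 x))\<^sup>2 \<partial>gauss_measure) \<le> 129 * real n * (\<integral>x. (g (cf_digit 1 x))\<^sup>2 \<partial>gauss_measure)"
    by (rule mult_left_mono) simp
  with second_moment_digit_sum_le[OF hb h0, of n] show ?thesis unfolding e by linarith
qed

section \<open>Stationarity of the digits and the truncated weak law\<close>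

lemma integral_digit_stationary:
  fixes h :: "nat \<Rightarrow> real"
  assumes "k \<ge> 1" "\<And>j. \<bar>h j\<bar> \<le> H"
  shows "(\<integral>x. h (cf_digit k x) \<partial>gauss_measure) = (\<integral>x. h (cf_digit 1 x) \<partial>gauss_measure)"
  using assms(1)
proof (induction k rule: dec_induct)
  case (step k)
  have "(\<integral>x. h (cf_digit (Suc k) x) \<partial>gauss_measure) = (\<integral>x. h (cf_digit k (gauss_map x)) \<partial>gauss_measure)"
    using step.hyps by (simp add: cf_digit_Suc)
  also have "\<dots> = (\<integral>x. h (cf_digit k x) \<partial>gauss_measure)"
    by (rule integral_gauss_invariant[where B = H]) (use assms in auto)
  finally show ?case using step.IH by simp
qed simp

lemma prob_digit_eq_integral:
  "\<P>(x in gauss_measure. Q (cf_digit k x)) = (\<integral>x. indicator {j. Q j} (cf_digit k x) \<partial>gauss_measure)"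
proof -
  have "(\<integral>x. indicator {j. Q j} (cf_digit k x) \<partial>gauss_measure) = (\<integral>x. indicator {x \<in> space gauss_measure. Q (cf_digit k x)} x \<partial>gauss_measure)"
    by (intro Bochner_Integration.integral_cong) (auto simp: indicator_def)
  also have "\<dots> = \<P>(x in gauss_measure. Q (cf_digit k x))"
    by (simp add: Int_absorb1)
  finally show ?thesis ..
qed

lemma prob_digit_stationary:
  assumes "k \<ge> 1"
  shows "\<P>(x in gauss_measure. Q (cf_digit k x)) = \<P>(x in gauss_measure. Q (cf_digit 1 x))"
  unfolding prob_digit_eq_integral by (rule integral_digit_stationary[where H = 1, OF assms]) (simp add: indicator_def)

lemma truncated_weak_law_bound:
  fixes f :: "real \<Rightarrow> real"
  assumes c: "c > 0" and e: "\<epsilon> > 0"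
  defines "a \<equiv> \<integral>x. f (real (cf_digit 1 x)) * indicator {x. \<bar>f (real (cf_digit 1 x))\<bar> \<le> c} x \<partial>gauss_measure"
  shows "\<P>(x in gauss_measure. \<bar>inverse c * ((\<Sum>k=1..n. f (real (cf_digit k x))) - real n * a)\<bar> > \<epsilon>)
    \<le> real n * \<P>(x in gauss_measure. \<bar>f (real (cf_digit 1 x))\<bar> > c)
      + 129 / \<epsilon>\<^sup>2 * (real n / c\<^sup>2 * (\<integral>x. (f (real (cf_digit 1 x)))\<^sup>2 * indicator {x. \<bar>f (real (cf_digit 1 x))\<bar> \<le> c} x \<partial>gauss_measure))"
proof -
  define g where "g k = (if \<bar>f (real k)\<bar> \<le> c then f (real k) else 0)" for k :: nat
  have g: "\<bar>g k\<bar> \<le> c" for k using c by (simp add: g_def)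
  have a: "a = (\<integral>x. g (cf_digit 1 x) \<partial>gauss_measure)"
    unfolding a_def g_def by (intro Bochner_Integration.integral_cong) (auto simp: indicator_def)
  have q: "(\<integral>x. (f (real (cf_digit 1 x)))\<^sup>2 * indicator {x. \<bar>f (real (cf_digit 1 x))\<bar> \<le> c} x \<partial>gauss_measure) = (\<integral>x. (g (cf_digit 1 x))\<^sup>2 \<partial>gauss_measure)"
    unfolding g_def by (intro Bochner_Integration.integral_cong) (auto simp: indicator_def)
  let ?T = "\<lambda>x. digit_sum g n x - real n * a"
  let ?A = "{x \<in> space gauss_measure. \<bar>inverse c * ((\<Sum>k=1..n. f (real (cf_digit k x))) - real n * a)\<bar> > \<epsilon>}"
  let ?B = "\<lambda>k. {x \<in> space gauss_measure. \<bar>f (real (cf_digit k x))\<bar> > c}"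
  let ?C = "{x \<in> space gauss_measure. (\<epsilon> * c)\<^sup>2 \<le> (?T x)\<^sup>2}"
  have [measurable]: "?C \<in> sets gauss_measure" "?B k \<in> sets gauss_measure" for k by measurable
  have "?A \<subseteq> (\<Union>k\<in>{1..n}. ?B k) \<union> ?C"
  proof
    fix x assume x: "x \<in> ?A"
    show "x \<in> (\<Union>k\<in>{1..n}. ?B k) \<union> ?C"
    proof (cases "\<exists>k\<in>{1..n}. \<bar>f (real (cf_digit k x))\<bar> > c")
      case False
      then have "(\<Sum>k=1..n. f (real (cf_digit k x))) = digit_sum g n x"
        unfolding digit_sum_def g_def by (intro sum.cong[OF refl]) (force simp: not_less)
      with x have "\<epsilon> < \<bar>?T x\<bar> / c" using c by (simp add: abs_mult field_simps)
      then have "\<epsilon> * c \<le> \<bar>?T x\<bar>" using c by (simp add: pos_less_divide_eq)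
      then have "(\<epsilon> * c)\<^sup>2 \<le> (?T x)\<^sup>2" using e c by (intro abs_le_square_iff[THEN iffD1]) auto
      then show ?thesis using x by simp
    qed (use x in auto)
  qed
  then have "measure gauss_measure ?A \<le> measure gauss_measure ((\<Union>k\<in>{1..n}. ?B k) \<union> ?C)"
    by (rule gauss.finite_measure_mono) measurable
  also have "\<dots> \<le> measure gauss_measure (\<Union>k\<in>{1..n}. ?B k) + measure gauss_measure ?C"
    by (rule measure_Un_le) measurable
  also have "measure gauss_measure (\<Union>k\<in>{1..n}. ?B k) \<le> (\<Sum>k\<in>{1..n}. measure gauss_measure (?B k))"
    by (rule gauss.finite_measure_subadditive_finite) auto
  also have "\<dots> = (\<Sum>k\<in>{1..n}. measure gauss_measure (?B 1))"
    by (intro sum.cong refl prob_digit_stationary[of _ "\<lambda>j. \<bar>f (real j)\<bar> > c"]) auto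
  also have "\<dots> = real n * measure gauss_measure (?B 1)" by simp
  also have "measure gauss_measure ?C \<le> (\<integral>x. (?T x)\<^sup>2 \<partial>gauss_measure) / (\<epsilon> * c)\<^sup>2"
  proof (rule integral_Markov_inequality_measure[where A = "{}"])
    have b: "\<bar>?T x\<bar> \<le> real n * c + real n * \<bar>a\<bar>" for x
    proof -
      have "\<bar>real n * a\<bar> = real n * \<bar>a\<bar>" by (simp add: abs_mult)
      then show ?thesis using digit_sum_bounded[of g c n x, OF g] by linarith
    qed
    have "(?T x)\<^sup>2 \<le> (real n * c + real n * \<bar>a\<bar>)\<^sup>2" for x
      using b[of x] c by (intro abs_le_square_iff[THEN iffD1]) simp
    then show "integrable gauss_measure (\<lambda>x. (?T x)\<^sup>2)"
      by (intro gauss_integrable_bounded[where M = "(real n * c + real n * \<bar>a\<bar>)\<^sup>2"]) auto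
  qed (use e c in auto)
  also have "\<dots> \<le> (129 * real n * (\<integral>x. (g (cf_digit 1 x))\<^sup>2 \<partial>gauss_measure)) / (\<epsilon> * c)\<^sup>2"
    unfolding a by (intro divide_right_mono variance_digit_sum_le[OF g]) simp
  finally show ?thesis unfolding q by (simp add: power_mult_distrib)
qed

subsection \<open>Characteristic functions and necessity\<close>

text \<open>Integrating out the first digit turns \<open>w\<close> into \<open>gauss_op h w\<close>,
  hence the induction over arbitrary \<open>w\<close>.\<close>

lemma integral_prod_digits:
  fixes w :: "real \<Rightarrow> complex"
  assumes h: "\<And>k. norm (h k) \<le> 1"
    and "w \<in> borel_measurable borel" "\<And>t. t \<in> {0..1} \<Longrightarrow> norm (w t) \<le> M"
  shows "(\<integral>x. (\<Prod>k=1..n. h (cf_digit k x)) * w x \<partial>gauss_measure) = (\<integral>x. (gauss_op h ^^ n) w x \<partial>gauss_measure)"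
  using assms(2,3)
proof (induction n arbitrary: w)
  case (Suc n)
  let ?G = "\<lambda>x. \<Prod>k=1..n. h (cf_digit k x)"
  have G: "?G \<in> borel_measurable borel" by measurable
  have G1: "norm (?G x) \<le> 1" for x unfolding prod_norm[symmetric] by (intro prod_le_1) (auto simp: h)
  have e: "(\<Prod>k=1..Suc n. h (cf_digit k x)) = h (cf_digit 1 x) * ?G (gauss_map x)" for x
  proof -
    have "(\<Prod>k=1..Suc n. h (cf_digit k x)) = h (cf_digit 1 x) * (\<Prod>k=Suc 1..Suc n. h (cf_digit k x))"
      by (subst prod.atLeast_Suc_atMost) auto
    also have "(\<Prod>k=Suc 1..Suc n. h (cf_digit k x)) = (\<Prod>k=1..n. h (cf_digit (Suc k) x))"
      by (rule prod.shift_bounds_cl_Suc_ivl)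
    also have "\<dots> = ?G (gauss_map x)" by (intro prod.cong) (auto simp: cf_digit_Suc)
    finally show ?thesis .
  qed
  have "(\<integral>x. (\<Prod>k=1..Suc n. h (cf_digit k x)) * w x \<partial>gauss_measure) = (\<integral>x. ?G x * gauss_op h w x \<partial>gauss_measure)"
    unfolding e by (rule integral_gauss_shift[where H = 1 and B = 1 and M = M]) (use h G G1 Suc.prems in auto)
  also have "\<dots> = (\<integral>x. (gauss_op h ^^ n) (gauss_op h w) x \<partial>gauss_measure)"
    using norm_gauss_op_funpow_le[of h w M _ 1, OF h Suc.prems(2)]
    by (intro Suc.IH digit_op_measurable Suc.prems) auto
  finally show ?case by (simp add: funpow_swap1)
qed simp

lemma norm_integral_prod_digits_le:
  assumes h: "\<And>k. norm (h k) \<le> (1::real)"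
  shows "norm (\<integral>x. (\<Prod>k=1..n. h (cf_digit k x)) \<partial>gauss_measure) \<le> (1 - digit_spread h / 2 ^ 15) ^ (n div 13)"
proof -
  let ?r = "(1 - digit_spread h / 2 ^ 15) ^ (n div 13)" and ?L = "(gauss_op h ^^ n) (\<lambda>_. 1)"
  have [measurable]: "?L \<in> borel_measurable borel"
    by (induction n) (auto intro: digit_op_measurable)
  have b: "norm (?L x) \<le> ?r" if "x \<in> {0..1}" for x by (rule norm_gauss_op_funpow_1_le[OF h that])
  have r0: "?r \<ge> 0" using norm_ge_zero b[of 0] by (rule order_trans) simp
  have "(\<integral>x. (\<Prod>k=1..n. h (cf_digit k x)) \<partial>gauss_measure) = (\<integral>x. ?L x \<partial>gauss_measure)"
    using integral_prod_digits[of h "\<lambda>_. 1" 1 n, OF h] by simp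
  also have "norm \<dots> \<le> (\<integral>x. norm (?L x) \<partial>gauss_measure)" by (rule integral_norm_bound)
  also have "\<dots> \<le> (\<integral>x. ?r \<partial>gauss_measure)"
    by (rule gauss_measure_bounded_mono[where M = ?r]) (use b r0 in auto)
  finally show ?thesis by (simp add: gauss.prob_space)
qed

section \<open>Characteristic functions of normed digit sums\<close>

lemma prod_cis: "finite A \<Longrightarrow> (\<Prod>k\<in>A. cis (g k)) = cis (\<Sum>k\<in>A. g k)"
  by (induction A rule: finite_induct) (auto simp: cis_mult)

lemma norm_cis_diff_power2: "(norm (cis a - cis b))\<^sup>2 = 2 - 2 * cos (a - b)"
proof -
  have "(norm (cis a - cis b))\<^sup>2 = ((cos a)\<^sup>2 + (sin a)\<^sup>2) + ((cos b)\<^sup>2 + (sin b)\<^sup>2) - 2 * (cos a * cos b + sin a * sin b)"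
    unfolding cmod_power2 by (simp add: power2_eq_square algebra_simps)
  then show ?thesis by (simp add: cos_diff)
qed

text \<open>The unknown mean is replaced by the concrete value \<open>h 1\<close>. Since the digit 1
  has weight 1/2, the squared distance of \<open>h 1\<close> from the mean is at most
  \<open>2 * V\<close>; then 6 = 2 + 2 * 2 by the triangle inequality.\<close>

lemma sum_digit_dist_le_spread:
  assumes h: "\<And>k. norm (h k) \<le> 1"
  shows "(\<Sum>k<N. cf_weight k 0 * (norm (h (Suc k) - h 1))\<^sup>2) \<le> 6 * digit_spread h"
proof -
  let ?m = "\<lambda>k. cf_weight k 0" and ?z = "digit_mean h"
  have m0: "?m k \<ge> 0" for k by (simp add: cf_weight_nonneg)
  obtain V where V: "(\<lambda>k. ?m k * (norm (h (Suc k) - ?z))\<^sup>2) sums V" "V \<le> digit_spread h"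
    unfolding digit_spread_def by (rule digit_variance[of h, OF h digit_mean_sums(1)[of h, OF h]]) blast
  have part: "(\<Sum>k\<in>A. ?m k * (norm (h (Suc k) - ?z))\<^sup>2) \<le> V" if "finite A" for A
    unfolding sums_unique[OF V(1)] by (rule sum_le_suminf[OF sums_summable[OF V(1)] that]) (simp add: m0)
  have one: "(norm (h 1 - ?z))\<^sup>2 \<le> 2 * V"
    using part[of "{0}"] by (simp add: cf_weight_def)
  have tri: "(norm (h (Suc k) - h 1))\<^sup>2 \<le> 2 * (norm (h (Suc k) - ?z))\<^sup>2 + 2 * (norm (h 1 - ?z))\<^sup>2" for k
  proof -
    have "norm (h (Suc k) - h 1) \<le> norm (h (Suc k) - ?z) + norm (h 1 - ?z)"
      using norm_triangle_ineq4[of "h (Suc k) - ?z" "h 1 - ?z"] by simp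
    then have "(norm (h (Suc k) - h 1))\<^sup>2 \<le> (norm (h (Suc k) - ?z) + norm (h 1 - ?z))\<^sup>2"
      by (rule power_mono) simp
    also have "\<dots> \<le> 2 * (norm (h (Suc k) - ?z))\<^sup>2 + 2 * (norm (h 1 - ?z))\<^sup>2"
      using sum_squares_bound[of "norm (h (Suc k) - ?z)" "norm (h 1 - ?z)"] by (simp add: power2_sum)
    finally show ?thesis .
  qed
  have m1: "(\<Sum>k<N. ?m k) \<le> 1"
    using sum_le_suminf[OF sums_summable[OF cf_weight_sums_1[of 0]], of "{..<N}"] m0 sums_unique[OF cf_weight_sums_1[of 0]] by simp
  have "(\<Sum>k<N. ?m k * (norm (h (Suc k) - h 1))\<^sup>2) \<le> (\<Sum>k<N. ?m k * (2 * (norm (h (Suc k) - ?z))\<^sup>2 + 2 * (norm (h 1 - ?z))\<^sup>2))"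
    by (intro sum_mono mult_left_mono tri m0)
  also have "\<dots> = 2 * (\<Sum>k<N. ?m k * (norm (h (Suc k) - ?z))\<^sup>2) + (2 * (norm (h 1 - ?z))\<^sup>2) * (\<Sum>k<N. ?m k)"
    by (simp add: sum.distrib distrib_left sum_distrib_left sum_distrib_right mult_ac)
  also have "\<dots> \<le> 2 * V + (2 * (norm (h 1 - ?z))\<^sup>2) * 1"
    by (intro add_mono mult_left_mono part m1) auto
  also have "\<dots> \<le> 6 * digit_spread h" using one V(2) by linarith
  finally show ?thesis .
qed

text \<open>The real part suffices. Where \<open>X\<close> is small,
  \<open>cos (t * X x) = 1 - 2 * (sin (t * X x / 2))^2\<close>, and \<open>t <= 2\<close> makes the
  half angle at most \<open>\<epsilon>\<close>; elsewhere the cosine is at least -1, a loss of at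
  most 2.\<close>

lemma norm_char_ge:
  fixes X :: "real \<Rightarrow> real"
  assumes [measurable]: "X \<in> borel_measurable borel" and t: "t \<in> {0..2}" and e: "\<epsilon> > 0"
  shows "1 - (2 * \<epsilon>\<^sup>2 + 2 * \<P>(x in gauss_measure. \<bar>X x\<bar> > \<epsilon>)) \<le> norm (\<integral>x. cis (t * X x) \<partial>gauss_measure)"
proof -
  let ?A = "{x \<in> space gauss_measure. \<bar>X x\<bar> > \<epsilon>}"
  have [measurable]: "?A \<in> sets gauss_measure" by measurable
  have [measurable]: "(\<lambda>x. cis (t * X x)) \<in> borel_measurable borel"
    by (rule borel_measurable_continuous_on[of cis]) (auto intro: continuous_intros)
  have i: "integrable gauss_measure (\<lambda>x. cis (t * X x))"
    by (rule gauss_integrable_bounded[where M = 1]) auto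
  define I :: "real \<Rightarrow> real" where "I x = indicator ?A x" for x
  have I: "integrable gauss_measure I" "(\<integral>x. I x \<partial>gauss_measure) = measure gauss_measure ?A"
    unfolding I_def by (auto simp: gauss.emeasure_eq_measure Int_absorb1)
  have le: "1 - 2 * \<epsilon>\<^sup>2 - 2 * I x \<le> cos (t * X x)" if x: "x \<in> space gauss_measure" for x
  proof (cases "x \<in> ?A")
    case True
    then have "I x = 1" by (simp add: I_def)
    then show ?thesis using cos_ge_minus_one[of "t * X x"] zero_le_power2[of \<epsilon>] by linarith
  next
    case False
    then have "\<bar>X x\<bar> \<le> \<epsilon>" using x by auto
    then have "\<bar>t * X x / 2\<bar> \<le> 1 * \<epsilon>"
      using t unfolding abs_mult abs_divide times_divide_eq_left[symmetric] by (intro mult_mono) auto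
    then have "\<bar>sin (t * X x / 2)\<bar> \<le> \<epsilon>" using abs_sin_x_le_abs_x[of "t * X x / 2"] by linarith
    then have "(sin (t * X x / 2))\<^sup>2 \<le> \<epsilon>\<^sup>2" using e by (intro abs_le_square_iff[THEN iffD1]) auto
    moreover have "cos (t * X x) = 1 - 2 * (sin (t * X x / 2))\<^sup>2"
      using cos_double_sin[of "t * X x / 2"] by simp
    ultimately show ?thesis using False by (simp add: I_def)
  qed
  have "(\<integral>x. 1 - 2 * \<epsilon>\<^sup>2 - 2 * I x \<partial>gauss_measure) \<le> (\<integral>x. cos (t * X x) \<partial>gauss_measure)"
  proof (rule integral_mono)
    show "integrable gauss_measure (\<lambda>x. cos (t * X x))"
      by (rule gauss_integrable_bounded[where M = 1]) auto
  qed (use le I in auto)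
  also have "(\<integral>x. 1 - 2 * \<epsilon>\<^sup>2 - 2 * I x \<partial>gauss_measure) = 1 - 2 * \<epsilon>\<^sup>2 - 2 * measure gauss_measure ?A"
    using I by (simp add: gauss.prob_space)
  also have "(\<integral>x. cos (t * X x) \<partial>gauss_measure) = Re (\<integral>x. cis (t * X x) \<partial>gauss_measure)"
    using integral_Re[OF i] by simp
  also have "\<dots> \<le> norm (\<integral>x. cis (t * X x) \<partial>gauss_measure)" by (rule complex_Re_le_cmod)
  finally show ?thesis by simp
qed

text \<open>The integral of $2 - 2\cos(ty)$ over $t \in [0,2]$.\<close>
definition cos_mean :: "real \<Rightarrow> real" where
  "cos_mean y = (if y = 0 then 0 else 4 - 2 * sin (2 * y) / y)"

lemma has_integral_cos_mean: "((\<lambda>t. 2 - 2 * cos (t * y)) has_integral cos_mean y) {0..2}"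
proof (cases "y = 0")
  case False
  have "((\<lambda>t. 2 - 2 * cos (t * y)) has_integral ((2 * 2 - 2 * sin (2 * y) / y) - (2 * 0 - 2 * sin (0 * y) / y))) {0..2}"
    using False by (intro fundamental_theorem_of_calculus)
      (auto intro!: derivative_eq_intros simp: has_real_derivative_iff_has_vector_derivative[symmetric])
  then show ?thesis using False by (simp add: cos_mean_def)
qed (simp add: cos_mean_def)

text \<open>For \<open>y >= 1\<close> the subtracted term is at most 2. For \<open>0 < y < 1\<close>
  the cubic Taylor polynomial of the sine with its fifth-order remainder is precise enough; negative
  \<open>y\<close> follow by evenness.\<close>

lemma cos_mean_ge: "min 1 (y\<^sup>2) \<le> cos_mean y"
proof (cases "y = 0")
  case y: False
  have pos: "min 1 (y\<^sup>2) \<le> 4 - 2 * sin (2 * y) / y" if y: "y > 0" for y :: real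
  proof (cases "y \<ge> 1")
    case True
    have "2 * sin (2 * y) / y \<le> 2 / 1" using True sin_le_one[of "2 * y"] by (intro frac_le) auto
    then show ?thesis by linarith
  next
    case False
    have "\<bar>sin (2 * y) - (\<Sum>m<5. sin_coeff m * (2 * y) ^ m)\<bar> \<le> inverse (fact 5) * \<bar>2 * y\<bar> ^ 5"
      by (rule Maclaurin_sin_bound)
    moreover have "(\<Sum>m<5. sin_coeff m * (2 * y) ^ m) = 2 * y - 4 / 3 * y ^ 3"
      by (simp add: sin_coeff_def lessThan_nat_numeral fact_numeral)
    moreover have "inverse (fact 5) * \<bar>2 * y\<bar> ^ 5 = 4 / 15 * y ^ 5"
      using y by (simp add: fact_numeral power_mult_distrib)
    ultimately have "sin (2 * y) \<le> 2 * y - 4 / 3 * y ^ 3 + 4 / 15 * y ^ 5" by linarith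
    moreover have "y ^ 5 \<le> y ^ 3" using y False by (intro power_decreasing) auto
    moreover have "y ^ 3 \<ge> 0" using y by simp
    ultimately have "2 * sin (2 * y) \<le> 4 * y - y ^ 3" by linarith
    then have "2 * sin (2 * y) / y \<le> (4 * y - y ^ 3) / y" using y by (intro divide_right_mono) auto
    also have "\<dots> = 4 - y\<^sup>2" using y by (simp add: field_simps power2_eq_square power3_eq_cube)
    finally show ?thesis by simp
  qed
  show ?thesis
  proof (cases "y > 0")
    case True then show ?thesis using pos[OF True] by (simp add: cos_mean_def)
  next
    case False then show ?thesis using pos[of "- y"] y by (simp add: cos_mean_def)
  qed
qed (simp add: cos_mean_def)

section \<open>Dispersion of f around its value at the digit 1\<close>

definition digit_dispersion :: "(real \<Rightarrow> real) \<Rightarrow> real \<Rightarrow> real" where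
  "digit_dispersion f c = (\<Sum>k. cf_weight k 0 * min 1 (((f (real (Suc k)) - f 1) / c)\<^sup>2))"

lemma digit_dispersion_summable: "summable (\<lambda>k. cf_weight k 0 * min 1 (((f (real (Suc k)) - f 1) / c)\<^sup>2))"
  using norm_weighted_suminf_le(1)[OF sums_summable[OF cf_weight_sums_1[of 0]], of "\<lambda>k. min 1 (((f (real (Suc k)) - f 1) / c)\<^sup>2)" 1]
  by (simp add: cf_weight_nonneg)

lemma digit_dispersion_nonneg: "digit_dispersion f c \<ge> 0"
  unfolding digit_dispersion_def by (intro suminf_nonneg digit_dispersion_summable) (auto simp: cf_weight_nonneg)

text \<open>The constant collects 26 * 2^16 from the decay estimate, 6 from
  \<open>sum_digit_dist_le_spread\<close> and 2 from the length of the interval of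
  \<open>t\<close>.\<close>

lemma digit_dispersion_le:
  fixes f :: "real \<Rightarrow> real" and b :: real
  assumes c: "c > 0" and e: "\<epsilon> > 0" and n: "n \<ge> 13"
  defines "q \<equiv> 2 * \<epsilon>\<^sup>2 + 2 * \<P>(x in gauss_measure. \<bar>inverse c * ((\<Sum>k=1..n. f (real (cf_digit k x))) - b)\<bar> > \<epsilon>)"
  assumes q: "q \<le> 1 / 2"
  shows "real n * digit_dispersion f c \<le> 312 * 2 ^ 16 * q"
proof -
  let ?m = "\<lambda>k. cf_weight k 0"
  define Y where "Y k = (f (real (Suc k)) - f 1) / c" for k
  define h where "h t k = cis (t * (f (real k) / c))" for t and k :: nat
  have h1: "norm (h t k) \<le> 1" for t k by (simp add: h_def)
  let ?X = "\<lambda>x. inverse c * ((\<Sum>k=1..n. f (real (cf_digit k x))) - b)"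
  have X: "?X \<in> borel_measurable borel"
    using digit_comp_measurable[of "\<lambda>j. f (real j)"] by measurable
  have nD: "real n * digit_spread (h t) \<le> 26 * 2 ^ 16 * q" if t: "t \<in> {0..2}" for t
  proof -
    define y where "y = real (n div 13) * (digit_spread (h t) / 2 ^ 15)"
    have D: "0 \<le> digit_spread (h t)" "digit_spread (h t) \<le> 1" using digit_spread_bounds[of "h t"] h1 by auto
    have y0: "y \<ge> 0" using D by (simp add: y_def)
    have "(\<Prod>k=1..n. h t (cf_digit k x)) = cis (t * b / c) * cis (t * ?X x)" for x
    proof -
      have "(\<Prod>k=1..n. h t (cf_digit k x)) = cis (\<Sum>k=1..n. t * (f (real (cf_digit k x)) / c))"
        unfolding h_def by (rule prod_cis) simp
      also have "(\<Sum>k=1..n. t * (f (real (cf_digit k x)) / c)) = t * b / c + t * ?X x"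
        using c by (simp add: sum_distrib_left[symmetric] sum_divide_distrib[symmetric] field_simps)
      finally show ?thesis by (simp add: cis_mult)
    qed
    \<comment> \<open>The centring constant \<open>b\<close> contributes only the factor
      \<open>cis (t * b / c)\<close> of modulus 1; this is why the bound is uniform in
      \<open>b\<close>.\<close>
    then have "norm (\<integral>x. (\<Prod>k=1..n. h t (cf_digit k x)) \<partial>gauss_measure) = norm (\<integral>x. cis (t * ?X x) \<partial>gauss_measure)"
      by (simp add: norm_mult)
    then have "1 - q \<le> (1 - digit_spread (h t) / 2 ^ 15) ^ (n div 13)"
      using norm_char_ge[OF X t e] norm_integral_prod_digits_le[of "h t" n, OF h1] unfolding q_def by linarith
    also have "\<dots> \<le> exp (- (digit_spread (h t) / 2 ^ 15)) ^ (n div 13)"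
      using D exp_ge_add_one_self[of "- (digit_spread (h t) / 2 ^ 15)"] by (intro power_mono) auto
    also have "\<dots> = exp (- y)" by (simp add: y_def exp_of_nat_mult[symmetric])
    also have "\<dots> = 1 / exp y" by (simp add: exp_minus divide_inverse)
    also have "\<dots> \<le> 1 / (1 + y)" using y0 exp_ge_add_one_self[of y] by (intro divide_left_mono) auto
    finally have "(1 - q) * (1 + y) \<le> 1" using y0 by (simp add: pos_le_divide_eq)
    \<comment> \<open>The previous inequality gives \<open>y <= q + y * q\<close>, and
      \<open>q <= 1/2\<close> lets the last term be absorbed.\<close>
    moreover have "y * q \<le> y * (1 / 2)" using y0 q by (intro mult_left_mono)
    ultimately have "y \<le> 2 * q" by (simp add: algebra_simps)
    then have "real (n div 13) * digit_spread (h t) \<le> 2 ^ 16 * q" by (simp add: y_def)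
    moreover have "real n * digit_spread (h t) \<le> (26 * real (n div 13)) * digit_spread (h t)"
    proof (intro mult_right_mono D)
      \<comment> \<open>For \<open>n >= 13\<close> the quotient \<open>n div 13\<close> is at least
        1, so rounding down loses at most a factor 2.\<close>
      have "n \<le> 26 * (n div 13)" using n by presburger
      then show "real n \<le> 26 * real (n div 13)" by linarith
    qed
    ultimately show ?thesis by linarith
  qed
  have part: "(\<Sum>k<N. real n * (?m k * (2 - 2 * cos (t * Y k)))) \<le> 156 * 2 ^ 16 * q" if t: "t \<in> {0..2}" for N t
  proof -
    have "(norm (h t (Suc k) - h t 1))\<^sup>2 = 2 - 2 * cos (t * Y k)" for k
      unfolding h_def norm_cis_diff_power2 Y_def by (simp add: diff_divide_distrib right_diff_distrib)
    then have "(\<Sum>k<N. ?m k * (2 - 2 * cos (t * Y k))) \<le> 6 * digit_spread (h t)"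
      using sum_digit_dist_le_spread[of "h t" N, OF h1] by simp
    then have "real n * (\<Sum>k<N. ?m k * (2 - 2 * cos (t * Y k))) \<le> real n * (6 * digit_spread (h t))"
      by (rule mult_left_mono) simp
    then show ?thesis using nD[OF t] by (simp add: sum_distrib_left)
  qed
  \<comment> \<open>Integration over \<open>t\<close> is carried out for finite partial sums with a
    bound independent of \<open>N\<close>, which avoids exchanging it with the series.\<close>
  have "(\<Sum>k<N. ?m k * min 1 ((Y k)\<^sup>2)) \<le> 312 * 2 ^ 16 * q / real n" for N
  proof -
    have "((\<lambda>t. \<Sum>k<N. real n * (?m k * (2 - 2 * cos (t * Y k)))) has_integral (\<Sum>k<N. real n * (?m k * cos_mean (Y k)))) {0..2}"
      by (intro has_integral_sum has_integral_mult_right has_integral_cos_mean) auto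
    moreover have "((\<lambda>t. 156 * 2 ^ 16 * q) has_integral (2 * (156 * 2 ^ 16 * q))) {0..2::real}"
      using has_integral_const_real[of "156 * 2 ^ 16 * q" 0 2] by simp
    ultimately have "(\<Sum>k<N. real n * (?m k * cos_mean (Y k))) \<le> 2 * (156 * 2 ^ 16 * q)"
      by (rule has_integral_le) (rule part)
    moreover have "(\<Sum>k<N. real n * (?m k * min 1 ((Y k)\<^sup>2))) \<le> (\<Sum>k<N. real n * (?m k * cos_mean (Y k)))"
      by (intro sum_mono mult_left_mono cos_mean_ge) (auto simp: cf_weight_nonneg)
    ultimately have "real n * (\<Sum>k<N. ?m k * min 1 ((Y k)\<^sup>2)) \<le> 312 * 2 ^ 16 * q"
      by (simp add: sum_distrib_left)
    then show ?thesis using n by (simp add: pos_le_divide_eq mult.commute)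
  qed
  then have "digit_dispersion f c \<le> 312 * 2 ^ 16 * q / real n"
    unfolding digit_dispersion_def by (intro suminf_le_const digit_dispersion_summable) (simp add: Y_def)
  then show ?thesis using n by (simp add: pos_le_divide_eq mult.commute)
qed

lemma digit_dispersion_tendsto_0:
  fixes f :: "real \<Rightarrow> real"
  assumes c: "\<forall>n\<ge>1. c n > 0"
    and conv: "conv_in_prob gauss_measure
            (\<lambda>n x. inverse (c n) * ((\<Sum>k=1..n. f (real (cf_digit k x))) - b n)) (\<lambda>_. 0)"
  shows "(\<lambda>n. real n * digit_dispersion f (c n)) \<longlonglongrightarrow> 0"
proof (rule LIMSEQ_I)
  fix r :: real assume r: "r > 0"
  define K :: real where "K = 312 * 2 ^ 16"
  have K: "K > 0" by (simp add: K_def)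
  define q where "q = min (1 / 2) (r / (2 * K))"
  have q: "q > 0" "q \<le> 1 / 2" "K * q \<le> r / 2"
  proof -
    show "q > 0" "q \<le> 1 / 2" using r K by (auto simp: q_def)
    have "K * q \<le> K * (r / (2 * K))" using K by (intro mult_left_mono) (auto simp: q_def)
    then show "K * q \<le> r / 2" using K by simp
  qed
  \<comment> \<open>Half of the budget \<open>q\<close> goes to \<open>2 * \<epsilon>^2\<close>; the
    other half covers twice the probability once that is below \<open>q / 4\<close>.\<close>
  define \<epsilon> where "\<epsilon> = sqrt (q / 4)"
  have e: "\<epsilon> > 0" "\<epsilon>\<^sup>2 = q / 4" using q by (auto simp: \<epsilon>_def)
  let ?P = "\<lambda>n. \<P>(x in gauss_measure. \<bar>inverse (c n) * ((\<Sum>k=1..n. f (real (cf_digit k x))) - b n)\<bar> > \<epsilon>)"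
  have "?P \<longlonglongrightarrow> 0" using conv e(1) unfolding conv_in_prob_def by simp
  then have "\<forall>\<^sub>F n in sequentially. ?P n < q / 4" using q(1) by (intro order_tendstoD(2)) auto
  then have "\<forall>\<^sub>F n in sequentially. norm (real n * digit_dispersion f (c n) - 0) < r"
    using eventually_ge_at_top[of 13]
  proof eventually_elim
    case (elim n)
    have le: "2 * \<epsilon>\<^sup>2 + 2 * ?P n \<le> q" using elim e by simp
    have "real n * digit_dispersion f (c n) \<le> K * (2 * \<epsilon>\<^sup>2 + 2 * ?P n)"
      unfolding K_def by (rule digit_dispersion_le) (use c elim e le q in auto)
    also have "\<dots> \<le> K * q" using le K by (intro mult_left_mono) auto
    also have "\<dots> < r" using q r by simp
    finally show ?case using digit_dispersion_nonneg[of f "c n"] by simp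
  qed
  then show "\<exists>no. \<forall>n\<ge>no. norm (real n * digit_dispersion f (c n) - 0) < r"
    by (simp add: eventually_sequentially)
qed

section \<open>From the dispersion back to the tail and the truncated moment\<close>

lemma expectation_le_dispersion:
  fixes h :: "nat \<Rightarrow> real"
  assumes h: "\<And>k. 0 \<le> h k" "\<And>k. h k \<le> H"
    and le: "\<And>k. h (Suc k) \<le> a * min 1 (((f (real (Suc k)) - f 1) / c)\<^sup>2) + b"
  shows "(\<integral>x. h (cf_digit 1 x) \<partial>gauss_measure) \<le> 2 * (a * digit_dispersion f c + b)"
proof -
  let ?m = "\<lambda>k. cf_weight k 0"
  have "norm (h (Suc k)) \<le> H" for k using h[of "Suc k"] by simp
  from norm_weighted_suminf_le(1)[OF sums_summable[OF cf_weight_sums_1[of 0]] _ this]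
  have "summable (\<lambda>k. ?m k * h (Suc k))" by (simp add: cf_weight_nonneg)
  then obtain m where m: "(\<lambda>k. ?m k * h (Suc k)) sums m" by (auto simp: summable_def)
  have "(\<lambda>k. a * (?m k * min 1 (((f (real (Suc k)) - f 1) / c)\<^sup>2)) + ?m k * b) sums (a * digit_dispersion f c + 1 * b)"
    unfolding digit_dispersion_def
    by (intro sums_add sums_mult sums_mult2 summable_sums digit_dispersion_summable cf_weight_sums_1) simp
  then have "m \<le> a * digit_dispersion f c + 1 * b"
  proof (rule sums_le[OF _ m, rotated])
    fix k
    have "?m k * h (Suc k) \<le> ?m k * (a * min 1 (((f (real (Suc k)) - f 1) / c)\<^sup>2) + b)"
      by (intro mult_left_mono le) (simp add: cf_weight_nonneg)
    then show "?m k * h (Suc k) \<le> a * (?m k * min 1 (((f (real (Suc k)) - f 1) / c)\<^sup>2)) + ?m k * b"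
      by (simp add: algebra_simps)
  qed
  \<comment> \<open>The factor 2 is the price of passing from mu to the law of the first digit under
    the Gauss measure.\<close>
  then show ?thesis using first_digit_law_bounds(2)[of h H, OF h m] by simp
qed

text \<open>If \<open>f\<close> exceeds \<open>c\<close> in modulus while \<open>f 1\<close> stays
  within \<open>c / 2\<close>, their difference is at least \<open>c / 2\<close>, so the truncated
  square is at least 1/4. Hence 8 = 4 * 2.\<close>

lemma tail_le_dispersion:
  fixes f :: "real \<Rightarrow> real"
  assumes c: "c > 0" "\<bar>f 1\<bar> \<le> c / 2"
  shows "\<P>(x in gauss_measure. \<bar>f (real (cf_digit 1 x))\<bar> > c) \<le> 8 * digit_dispersion f c"
proof -
  have "indicator {j. \<bar>f (real j)\<bar> > c} (Suc k) \<le> 4 * min 1 (((f (real (Suc k)) - f 1) / c)\<^sup>2) + 0" for k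
  proof (cases "\<bar>f (real (Suc k))\<bar> > c")
    case True
    then have "c / 2 \<le> \<bar>f (real (Suc k)) - f 1\<bar>" using c by linarith
    then have "1 / 2 \<le> \<bar>(f (real (Suc k)) - f 1) / c\<bar>" using c by (simp add: field_simps)
    then have "(1 / 2)\<^sup>2 \<le> \<bar>(f (real (Suc k)) - f 1) / c\<bar>\<^sup>2" by (rule power_mono) simp
    moreover have "(1 / 2 :: real)\<^sup>2 = 1 / 4" by (simp add: power2_eq_square)
    ultimately have "1 \<le> 4 * ((f (real (Suc k)) - f 1) / c)\<^sup>2" unfolding power2_abs by linarith
    then show ?thesis using True by (simp add: min_def)
  qed simp
  from expectation_le_dispersion[where H = 1, OF _ _ this]
  show ?thesis unfolding prob_digit_eq_integral[of "\<lambda>j. \<bar>f (real j)\<bar> > c"] by simp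
qed

text \<open>Below the truncation level the difference \<open>f - f 1\<close> is at most
  \<open>2 * c\<close>, so its square is at most \<open>4 * c^2\<close> times the truncated
  normalised square. Adding back \<open>f 1\<close> leaves a term that the dispersion does not
  see.\<close>

lemma truncated_moment_le_dispersion:
  fixes f :: "real \<Rightarrow> real"
  assumes c: "c > 0" "\<bar>f 1\<bar> \<le> c / 2"
  shows "(\<integral>x. (f (real (cf_digit 1 x)))\<^sup>2 * indicator {x. \<bar>f (real (cf_digit 1 x))\<bar> \<le> c} x \<partial>gauss_measure)
     \<le> 16 * c\<^sup>2 * digit_dispersion f c + 4 * (f 1)\<^sup>2"
proof -
  define h where "h j = (if \<bar>f (real j)\<bar> \<le> c then (f (real j))\<^sup>2 else 0)" for j :: nat
  have h0: "h j \<ge> 0" for j by (simp add: h_def)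
  have hc: "h j \<le> c\<^sup>2" for j using c by (auto simp: h_def abs_le_square_iff[symmetric])
  have "h (Suc k) \<le> 8 * c\<^sup>2 * min 1 (((f (real (Suc k)) - f 1) / c)\<^sup>2) + 2 * (f 1)\<^sup>2" for k
  proof (cases "\<bar>f (real (Suc k))\<bar> \<le> c")
    case True
    let ?d = "f (real (Suc k)) - f 1"
    have "\<bar>?d\<bar> \<le> \<bar>2 * c\<bar>" using True c by linarith
    then have "?d\<^sup>2 \<le> (2 * c)\<^sup>2" by (simp add: abs_le_square_iff)
    then have d4: "?d\<^sup>2 \<le> 4 * c\<^sup>2" by (simp add: power_mult_distrib)
    have "4 * c\<^sup>2 * min 1 ((?d / c)\<^sup>2) = min (4 * c\<^sup>2) (4 * ?d\<^sup>2)"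
      using c by (simp add: min_mult_distrib_left power_divide)
    then have "?d\<^sup>2 \<le> 4 * c\<^sup>2 * min 1 ((?d / c)\<^sup>2)" using d4 by simp
    moreover have "(f (real (Suc k)))\<^sup>2 \<le> 2 * ?d\<^sup>2 + 2 * (f 1)\<^sup>2"
    proof -
      have "2 * ?d\<^sup>2 + 2 * (f 1)\<^sup>2 - (f (real (Suc k)))\<^sup>2 = (f (real (Suc k)) - 2 * f 1)\<^sup>2"
        by (simp add: power2_eq_square algebra_simps)
      then show ?thesis using zero_le_power2[of "f (real (Suc k)) - 2 * f 1"] by linarith
    qed
    moreover have "h (Suc k) = (f (real (Suc k)))\<^sup>2" using True by (simp add: h_def)
    ultimately show ?thesis by linarith
  qed (simp add: h_def)
  note b = expectation_le_dispersion[of h, OF h0 hc this]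
  have "(\<integral>x. (f (real (cf_digit 1 x)))\<^sup>2 * indicator {x. \<bar>f (real (cf_digit 1 x))\<bar> \<le> c} x \<partial>gauss_measure) = (\<integral>x. h (cf_digit 1 x) \<partial>gauss_measure)"
    unfolding h_def by (intro Bochner_Integration.integral_cong) (auto simp: indicator_def)
  then show ?thesis using b by simp
qed

text \<open>The only place where the nonzero constant functions have to be excluded.\<close>
lemma first_value_negligible:
  fixes f :: "real \<Rightarrow> real"
  assumes ne: "\<nexists>d. d \<noteq> 0 \<and> (\<forall>k::nat\<ge>1. f (real k) = d)"
    and c: "\<forall>n\<ge>1. c n > 0" "filterlim c at_top sequentially"
    and disp: "(\<lambda>n. real n * digit_dispersion f (c n)) \<longlonglongrightarrow> 0"
  shows "(\<lambda>n. real n / (c n)\<^sup>2 * (f 1)\<^sup>2) \<longlonglongrightarrow> 0"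
proof (cases "f 1 = 0")
  case False
  with ne obtain k where k: "k \<ge> 1" "f (real k) \<noteq> f 1" by metis
  define d where "d = f (real k) - f 1"
  define \<mu> where "\<mu> = cf_weight (k - 1) 0"
  have d: "d \<noteq> 0" using k by (simp add: d_def)
  have m: "\<mu> > 0" by (simp add: \<mu>_def cf_weight_def)
  \<comment> \<open>A single digit value \<open>k\<close> at which \<open>f\<close> differs from
    \<open>f 1\<close> suffices: once \<open>c n >= \<bar>d\<bar>\<close> the truncation is
    inactive, and this one summand of the dispersion is a fixed positive multiple of
    \<open>1 / (c n)^2\<close>.\<close>
  have le: "real n / (c n)\<^sup>2 * (f 1)\<^sup>2 \<le> ((f 1)\<^sup>2 / (\<mu> * d\<^sup>2)) * (real n * digit_dispersion f (c n))"
    if n: "n \<ge> 1" "c n \<ge> \<bar>d\<bar>" for n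
  proof -
    have cn: "c n > 0" using c n by auto
    have "(d / c n)\<^sup>2 \<le> 1" using n cn by (simp add: abs_square_le_1)
    then have "\<mu> * (d / c n)\<^sup>2 = (\<Sum>j\<in>{k - 1}. cf_weight j 0 * min 1 (((f (real (Suc j)) - f 1) / c n)\<^sup>2))"
      using k by (simp add: \<mu>_def d_def)
    also have "\<dots> \<le> digit_dispersion f (c n)"
      unfolding digit_dispersion_def by (intro sum_le_suminf digit_dispersion_summable) (auto simp: cf_weight_nonneg)
    finally have "real n * (\<mu> * (d / c n)\<^sup>2) \<le> real n * digit_dispersion f (c n)" by (rule mult_left_mono) simp
    then have "((f 1)\<^sup>2 / (\<mu> * d\<^sup>2)) * (real n * (\<mu> * (d / c n)\<^sup>2)) \<le> ((f 1)\<^sup>2 / (\<mu> * d\<^sup>2)) * (real n * digit_dispersion f (c n))"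
      by (rule mult_left_mono) (use m in simp)
    moreover have "((f 1)\<^sup>2 / (\<mu> * d\<^sup>2)) * (real n * (\<mu> * (d / c n)\<^sup>2)) = real n / (c n)\<^sup>2 * (f 1)\<^sup>2"
      using m d by (simp add: power_divide)
    ultimately show ?thesis by simp
  qed
  have "\<forall>\<^sub>F n in sequentially. c n \<ge> \<bar>d\<bar>" using c(2) by (simp add: filterlim_at_top)
  then have ev: "\<forall>\<^sub>F n in sequentially. real n / (c n)\<^sup>2 * (f 1)\<^sup>2 \<le> ((f 1)\<^sup>2 / (\<mu> * d\<^sup>2)) * (real n * digit_dispersion f (c n))"
    using eventually_ge_at_top[of 1] by eventually_elim (rule le)
  have "(\<lambda>n. ((f 1)\<^sup>2 / (\<mu> * d\<^sup>2)) * (real n * digit_dispersion f (c n))) \<longlonglongrightarrow> 0"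
    using disp by (rule tendsto_mult_right_zero)
  from tendsto_sandwich[OF _ ev tendsto_const this] show ?thesis by simp
qed simp

text \<open>The equivalence is restricted because it fails for a nonzero constant: if
  \<open>f\<close> equals \<open>d\<close> at all positive integers, \<open>b n = n * d\<close>
  makes the normed sums vanish almost surely, whereas the second condition becomes
  \<open>n * d^2 / (c n)^2\<close> tending to 0, which is false for \<open>c n = sqrt n\<close>. The
  second half, with the explicit \<open>b\<close>, is stated for constants too.\<close>

theorem theorem1:
  fixes c :: "nat \<Rightarrow> real" and f :: "real \<Rightarrow> real"
  assumes "\<forall>n\<ge>1. c n > 0"
    and "filterlim c at_top sequentially"
    and "f \<in> borel_measurable borel"
  shows
    "((\<nexists>d. d \<noteq> 0 \<and> (\<forall>k::nat\<ge>1. f (real k) = d)) \<longrightarrow>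
      ((\<exists>b :: nat \<Rightarrow> real.
          conv_in_prob gauss_measure
            (\<lambda>n x. inverse (c n) * ((\<Sum>k=1..n. f (real (cf_digit k x))) - b n)) (\<lambda>_. 0)) \<longleftrightarrow>
       (\<lambda>n. real n * \<P>(x in gauss_measure. \<bar>f (real (cf_digit 1 x))\<bar> > c n)) \<longlonglongrightarrow> 0 \<and>
       (\<lambda>n. real n / (c n)\<^sup>2 *
          (\<integral>x. (f (real (cf_digit 1 x)))\<^sup>2 * indicator {x. \<bar>f (real (cf_digit 1 x))\<bar> \<le> c n} x
             \<partial>gauss_measure)) \<longlonglongrightarrow> 0)) \<and>
     ((\<lambda>n. real n * \<P>(x in gauss_measure. \<bar>f (real (cf_digit 1 x))\<bar> > c n)) \<longlonglongrightarrow> 0 \<and>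
      (\<lambda>n. real n / (c n)\<^sup>2 *
          (\<integral>x. (f (real (cf_digit 1 x)))\<^sup>2 * indicator {x. \<bar>f (real (cf_digit 1 x))\<bar> \<le> c n} x
             \<partial>gauss_measure)) \<longlonglongrightarrow> 0 \<longrightarrow>
      conv_in_prob gauss_measure
        (\<lambda>n x. inverse (c n) * ((\<Sum>k=1..n. f (real (cf_digit k x))) -
           real n * (\<integral>x. f (real (cf_digit 1 x)) * indicator {x. \<bar>f (real (cf_digit 1 x))\<bar> \<le> c n} x
             \<partial>gauss_measure))) (\<lambda>_. 0))"
proof -
  let ?P = "\<lambda>n. \<P>(x in gauss_measure. \<bar>f (real (cf_digit 1 x))\<bar> > c n)"
  let ?Q = "\<lambda>n. \<integral>x. (f (real (cf_digit 1 x)))\<^sup>2 * indicator {x. \<bar>f (real (cf_digit 1 x))\<bar> \<le> c n} x \<partial>gauss_measure"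
  let ?a = "\<lambda>n. \<integral>x. f (real (cf_digit 1 x)) * indicator {x. \<bar>f (real (cf_digit 1 x))\<bar> \<le> c n} x \<partial>gauss_measure"
  let ?W = "\<lambda>b n x. inverse (c n) * ((\<Sum>k=1..n. f (real (cf_digit k x))) - b n)"
  let ?conv = "\<lambda>b. conv_in_prob gauss_measure (?W b) (\<lambda>_. 0)"
  let ?A = "(\<lambda>n. real n * ?P n) \<longlonglongrightarrow> 0" and ?B = "(\<lambda>n. real n / (c n)\<^sup>2 * ?Q n) \<longlonglongrightarrow> 0"
  have suff: "?conv (\<lambda>n. real n * ?a n)" if A: ?A and B: ?B
    unfolding conv_in_prob_def
  proof (intro allI impI)
    fix \<epsilon> :: real assume e: "\<epsilon> > 0"
    have "(\<lambda>n. real n * ?P n + 129 / \<epsilon>\<^sup>2 * (real n / (c n)\<^sup>2 * ?Q n)) \<longlonglongrightarrow> 0 + 129 / \<epsilon>\<^sup>2 * 0"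
      by (intro tendsto_add tendsto_mult tendsto_const A B)
    then have lim: "(\<lambda>n. real n * ?P n + 129 / \<epsilon>\<^sup>2 * (real n / (c n)\<^sup>2 * ?Q n)) \<longlonglongrightarrow> 0" by simp
    have "\<forall>\<^sub>F n in sequentially. \<P>(x in gauss_measure. \<bar>?W (\<lambda>n. real n * ?a n) n x\<bar> > \<epsilon>) \<le> real n * ?P n + 129 / \<epsilon>\<^sup>2 * (real n / (c n)\<^sup>2 * ?Q n)"
      using eventually_ge_at_top[of 1]
      by eventually_elim (rule truncated_weak_law_bound[OF _ e], use assms(1) in auto)
    from tendsto_sandwich[OF _ this tendsto_const lim]
    show "(\<lambda>n. \<P>(x in gauss_measure. \<bar>?W (\<lambda>n. real n * ?a n) n x - 0\<bar> > \<epsilon>)) \<longlonglongrightarrow> 0" by simp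
  qed
  have nec: "?A \<and> ?B" if ne: "\<nexists>d. d \<noteq> 0 \<and> (\<forall>k::nat\<ge>1. f (real k) = d)" and conv: "?conv b" for b
  proof -
    let ?D = "\<lambda>n. real n * digit_dispersion f (c n)"
    have D: "?D \<longlonglongrightarrow> 0" by (rule digit_dispersion_tendsto_0[OF assms(1) conv])
    have F: "(\<lambda>n. real n / (c n)\<^sup>2 * (f 1)\<^sup>2) \<longlonglongrightarrow> 0" by (rule first_value_negligible[OF ne assms(1,2) D])
    have "\<forall>\<^sub>F n in sequentially. 2 * \<bar>f 1\<bar> \<le> c n" using assms(2) by (simp add: filterlim_at_top)
    \<comment> \<open>Both comparisons with the dispersion need \<open>f 1\<close> to be at most
      half the truncation level, which holds eventually since \<open>c\<close> is unbounded.\<close>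
    then have ev: "\<forall>\<^sub>F n in sequentially. c n > 0 \<and> \<bar>f 1\<bar> \<le> c n / 2"
      using eventually_ge_at_top[of 1] by eventually_elim (use assms(1) in auto)
    have "\<forall>\<^sub>F n in sequentially. real n * ?P n \<le> 8 * ?D n"
      using ev
    proof eventually_elim
      case (elim n)
      have "real n * ?P n \<le> real n * (8 * digit_dispersion f (c n))"
        using elim by (intro mult_left_mono tail_le_dispersion) auto
      then show ?case by (simp only: mult.left_commute)
    qed
    moreover have "(\<lambda>n. 8 * ?D n) \<longlonglongrightarrow> 0" using D by (rule tendsto_mult_right_zero)
    ultimately have A: ?A by (rule tendsto_sandwich[OF _ _ tendsto_const, rotated]) simp
    have "\<forall>\<^sub>F n in sequentially. real n / (c n)\<^sup>2 * ?Q n \<le> 16 * ?D n + 4 * (real n / (c n)\<^sup>2 * (f 1)\<^sup>2)"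
      using ev
    proof eventually_elim
      case (elim n)
      have "real n / (c n)\<^sup>2 * ?Q n \<le> real n / (c n)\<^sup>2 * (16 * (c n)\<^sup>2 * digit_dispersion f (c n) + 4 * (f 1)\<^sup>2)"
        using elim by (intro mult_left_mono truncated_moment_le_dispersion) auto
      also have "\<dots> = 16 * ?D n + 4 * (real n / (c n)\<^sup>2 * (f 1)\<^sup>2)" using elim by (simp add: field_simps)
      finally show ?case .
    qed
    moreover have "(\<lambda>n. 16 * ?D n + 4 * (real n / (c n)\<^sup>2 * (f 1)\<^sup>2)) \<longlonglongrightarrow> 0"
      using tendsto_add[OF tendsto_mult_right_zero[OF D, of 16] tendsto_mult_right_zero[OF F, of 4]] by simp
    ultimately have ?B by (rule tendsto_sandwich[OF _ _ tendsto_const, rotated]) simp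
    with A show ?thesis by blast
  qed
  have iff: "(\<exists>b. ?conv b) \<longleftrightarrow> ?A \<and> ?B" if ne: "\<nexists>d. d \<noteq> 0 \<and> (\<forall>k::nat\<ge>1. f (real k) = d)"
  proof
    assume "\<exists>b. ?conv b"
    then obtain b where "?conv b" ..
    then show "?A \<and> ?B" by (rule nec[OF ne])
  next
    assume "?A \<and> ?B"
    then have "?conv (\<lambda>n. real n * ?a n)" by (elim conjE) (rule suff)
    then show "\<exists>b. ?conv b" by (rule exI[where x = "\<lambda>n. real n * ?a n"])
  qed
  show ?thesis
    by (intro conjI[OF impI impI] iff) (assumption, elim conjE, rule suff)
qed

end
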